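(* Consider Cantor space $2^{\mathbb N}$ with the Lebesgue measure $\lambda$. Let $x\in 2^{\mathbb N}$ not be Kurtz random. Then there are a clopen set $A\ni x$ with $\lambda(A)>0$ and an injective computable ergodic measure-preserving transformation $T:\subseteq 2^{\mathbb N}\to 2^{\mathbb N}$, with $\operatorname{dom}T$ a $\Sigma^0_1$ set containing $A$, such that $T^k(x)\notin A$ for all $k>0$.
   Context: For a finite binary string $\sigma$, $[\![\sigma]\!]=\{x\in 2^{\mathbb N}:\sigma\text{ is an initial segment of }x\}$; these cylinders are the basic open sets of Cantor space. The Lebesgue measure $\lambda$ is the Borel probability measure with $\lambda[\![\sigma]\!]=2^{-|\sigma|}$. A set is $\Sigma^0_1$ if it is $\bigcup_{\sigma\in W}[\![\sigma]\!]$ for a c.e. set $W$ of strings, and $\Pi^0_1$ if its complement is $\Sigma^0_1$. A point is Kurtz random if it lies in no $\lambda$-null $\Pi^0_1$ set. A measure-preserving transformation is a partial Borel measurable map $T:\subseteq 2^{\mathbb N}\to 2^{\mathbb N}$ such that $\lambda(T^{-1}(B))=\lambda(B)$ for every Borel $B$ (so $\operatorname{dom}T$ has full measure) and $x\in\operatorname{dom}T$ implies $T(x)\in\operatorname{dom}T$. It is computable if, uniformly in $\sigma$, $T^{-1}[\![\sigma]\!]$ is the intersection of $\operatorname{dom}T$ with a $\Sigma^0_1$ set. It is ergodic if every Borel $B$ with $T^{-1}(B)=B$ has measure $0$ or $1$. *)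

theory Defs
  imports "HOL-Probability.Probability" "HOL-Library.Nat_Bijection"
begin

section \<open>Computable enumerability\<close>

text \<open>
  The total recursive functions of one argument, with \<^const>\<open>prod_encode\<close> as the pairing
  function; minimization is restricted to the regular case, in which every search
  succeeds, so that no partial functions are needed.
\<close>

inductive recursive_fun :: "(nat \<Rightarrow> nat) \<Rightarrow> bool" where
  zero: "recursive_fun (\<lambda>_. 0)"
| succ: "recursive_fun Suc"
| left: "recursive_fun (\<lambda>n. fst (prod_decode n))"
| right: "recursive_fun (\<lambda>n. snd (prod_decode n))"
| pair: "recursive_fun f \<Longrightarrow> recursive_fun g \<Longrightarrow> recursive_fun (\<lambda>n. prod_encode (f n, g n))"
| comp: "recursive_fun f \<Longrightarrow> recursive_fun g \<Longrightarrow> recursive_fun (\<lambda>n. f (g n))"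
| prim_rec: "recursive_fun f \<Longrightarrow> recursive_fun g \<Longrightarrow>
    recursive_fun (\<lambda>n. case prod_decode n of (a, m) \<Rightarrow>
      rec_nat (f a) (\<lambda>k r. g (prod_encode (a, prod_encode (k, r)))) m)"
| minimization: "recursive_fun f \<Longrightarrow> \<forall>a. \<exists>m. f (prod_encode (a, m)) = 0 \<Longrightarrow>
    recursive_fun (\<lambda>a. LEAST m. f (prod_encode (a, m)) = 0)"

definition ce :: "nat set \<Rightarrow> bool" where
  "ce S \<longleftrightarrow> S = {} \<or> (\<exists>f. recursive_fun f \<and> S = range f)"

definition string_code :: "bool list \<Rightarrow> nat" where
  "string_code \<sigma> = list_encode (map of_bool \<sigma>)"

definition ce_strings :: "bool list set \<Rightarrow> bool" where
  "ce_strings W \<longleftrightarrow> ce (string_code ` W)"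

definition ce_string_pairs :: "(bool list \<times> bool list) set \<Rightarrow> bool" where
  "ce_string_pairs W \<longleftrightarrow>
     ce ((\<lambda>(\<sigma>, \<tau>). prod_encode (string_code \<sigma>, string_code \<tau>)) ` W)"

lemma inj_string_code: "inj string_code"
proof (rule injI)
  fix \<sigma> \<tau> assume "string_code \<sigma> = string_code \<tau>"
  then have "map (of_bool :: bool \<Rightarrow> nat) \<sigma> = map of_bool \<tau>"
    by (metis string_code_def list_encode_inverse)
  moreover have "inj (of_bool :: bool \<Rightarrow> nat)"
    by (rule injI) (simp add: of_bool_eq_iff)
  ultimately show "\<sigma> = \<tau>"
    using inj_map_eq_map by blast
qed


section \<open>Cantor space and its Lebesgue measure\<close>

text \<open>The topology is the product topology on functions, with \<^typ>\<open>bool\<close> discrete.\<close>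

instance bool :: second_countable_topology
proof
  have "generate_topology (UNIV :: bool set set) S" for S
    by (rule generate_topology.Basis) simp
  then have "open = generate_topology (UNIV :: bool set set)"
    by (auto intro: Topological_Spaces.open_discrete)
  then show "\<exists>B::bool set set. countable B \<and> open = generate_topology B"
    by (intro exI[of _ UNIV]) (simp add: countable_finite)
qed

type_synonym cantor = "nat \<Rightarrow> bool"

definition cylinder :: "bool list \<Rightarrow> cantor set" where
  "cylinder \<sigma> = {x. \<forall>i<length \<sigma>. x i = \<sigma> ! i}"

definition cantor_measure :: "cantor measure" where
  "cantor_measure = PiM UNIV (\<lambda>_. measure_pmf (bernoulli_pmf (1/2)))"

definition Sigma01 :: "cantor set \<Rightarrow> bool" where
  "Sigma01 U \<longleftrightarrow> (\<exists>W. ce_strings W \<and> U = (\<Union>\<sigma>\<in>W. cylinder \<sigma>))"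

definition Pi01 :: "cantor set \<Rightarrow> bool" where
  "Pi01 P \<longleftrightarrow> Sigma01 (- P)"

definition Kurtz_random :: "cantor \<Rightarrow> bool" where
  "Kurtz_random x \<longleftrightarrow> \<not> (\<exists>P. Pi01 P \<and> emeasure cantor_measure P = 0 \<and> x \<in> P)"

lemma open_cylinder: "open (cylinder \<sigma>)"
proof -
  have "open {x :: cantor. \<forall>i\<in>{..<length \<sigma>}. x (id i) \<in> {\<sigma> ! i}}"
    by (rule product_topology_basis') (auto intro: Topological_Spaces.open_discrete)
  then show ?thesis
    by (simp add: cylinder_def Ball_def)
qed

lemma open_iff_Union_cylinder:
  "open (U :: cantor set) \<longleftrightarrow> (\<exists>W. U = (\<Union>\<sigma>\<in>W. cylinder \<sigma>))"
proof
  assume U: "open U"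
  have "\<exists>\<sigma>. x \<in> cylinder \<sigma> \<and> cylinder \<sigma> \<subseteq> U" if x: "x \<in> U" for x
  proof -
    obtain X where X: "x \<in> (\<Pi>\<^sub>E i\<in>UNIV. X i)" "finite {i. X i \<noteq> UNIV}" "(\<Pi>\<^sub>E i\<in>UNIV. X i) \<subseteq> U"
      using product_topology_open_contains_basis[of "\<lambda>_. euclidean" UNIV U x] U x
      by (auto simp: open_fun_def)
    obtain n where n: "\<And>i. X i \<noteq> UNIV \<Longrightarrow> i < n"
      using X(2) by (auto simp: finite_nat_set_iff_bounded)
    have "cylinder (map x [0..<n]) \<subseteq> (\<Pi>\<^sub>E i\<in>UNIV. X i)"
    proof
      fix y assume y: "y \<in> cylinder (map x [0..<n])"
      have "y i \<in> X i" for i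
        using n[of i] y X(1) by (cases "i < n") (auto simp: cylinder_def PiE_iff)
      then show "y \<in> (\<Pi>\<^sub>E i\<in>UNIV. X i)"
        by auto
    qed
    then show ?thesis
      using X(3) by (intro exI[of _ "map x [0..<n]"]) (auto simp: cylinder_def)
  qed
  then have "U = (\<Union>\<sigma>\<in>{\<sigma>. cylinder \<sigma> \<subseteq> U}. cylinder \<sigma>)"
    by blast
  then show "\<exists>W. U = (\<Union>\<sigma>\<in>W. cylinder \<sigma>)" ..
qed (auto intro: open_cylinder)

lemma prob_space_cantor_measure: "prob_space cantor_measure"
  unfolding cantor_measure_def by (intro prob_space_PiM measure_pmf.prob_space_axioms)

lemma sets_cantor_measure: "sets cantor_measure = sets borel"
proof -
  have "sets (measure_pmf (bernoulli_pmf (1/2))) = sets (borel :: bool measure)"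
    by (auto intro: borel_open Topological_Spaces.open_discrete)
  then have "sets cantor_measure = sets (PiM UNIV (\<lambda>_::nat. borel :: bool measure))"
    unfolding cantor_measure_def by (intro sets_PiM_cong) auto
  then show ?thesis
    by (simp add: sets_PiM_equal_borel)
qed

lemma emeasure_cylinder: "emeasure cantor_measure (cylinder \<sigma>) = (1/2) ^ length \<sigma>"
proof -
  interpret product_prob_space "\<lambda>_::nat. measure_pmf (bernoulli_pmf (1/2))" UNIV
    by unfold_locales
  have half: "emeasure (measure_pmf (bernoulli_pmf (1/2))) {b} = 1/2" for b
    by (cases b) (simp_all add: emeasure_pmf_single divide_ennreal_def inverse_ennreal[of 2, simplified])
  have "emeasure (PiM UNIV (\<lambda>_::nat. measure_pmf (bernoulli_pmf (1/2))))
          {x \<in> space (PiM UNIV (\<lambda>_::nat. measure_pmf (bernoulli_pmf (1/2)))).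
             \<forall>i\<in>{..<length \<sigma>}. x i \<in> {\<sigma> ! i}} =
        (\<Prod>i\<in>{..<length \<sigma>}. emeasure (measure_pmf (bernoulli_pmf (1/2))) {\<sigma> ! i})"
    by (rule emeasure_PiM_Collect) auto
  then show ?thesis
    by (simp add: half cantor_measure_def cylinder_def space_PiM Ball_def)
qed


section \<open>Partial transformations\<close>

definition partial_vimage :: "(cantor \<rightharpoonup> cantor) \<Rightarrow> cantor set \<Rightarrow> cantor set" where
  "partial_vimage T B = T -` (Some ` B)"

definition measure_preserving_transformation :: "(cantor \<rightharpoonup> cantor) \<Rightarrow> bool" where
  "measure_preserving_transformation T \<longleftrightarrow>
     (\<forall>B\<in>sets borel. partial_vimage T B \<in> sets borel \<and>
        emeasure cantor_measure (partial_vimage T B) = emeasure cantor_measure B) \<and>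
     ran T \<subseteq> dom T"

definition computable_transformation :: "(cantor \<rightharpoonup> cantor) \<Rightarrow> bool" where
  "computable_transformation T \<longleftrightarrow>
     (\<exists>W. ce_string_pairs W \<and>
        (\<forall>\<sigma>. partial_vimage T (cylinder \<sigma>) = dom T \<inter> (\<Union>\<tau>\<in>{\<tau>. (\<sigma>, \<tau>) \<in> W}. cylinder \<tau>)))"

definition ergodic_transformation :: "(cantor \<rightharpoonup> cantor) \<Rightarrow> bool" where
  "ergodic_transformation T \<longleftrightarrow>
     (\<forall>B\<in>sets borel. partial_vimage T B = B \<longrightarrow>
        emeasure cantor_measure B = 0 \<or> emeasure cantor_measure B = 1)"

primrec partial_iterate :: "('a \<rightharpoonup> 'a) \<Rightarrow> nat \<Rightarrow> 'a \<rightharpoonup> 'a" where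
  "partial_iterate T 0 = Some"
| "partial_iterate T (Suc k) = (\<lambda>x. Option.bind (partial_iterate T k x) T)"

end

theory Submission
  imports Defs
begin

text \<open>
  Let \<open>P\<close> be a null \<open>\<Pi>\<^sup>0\<^sub>1\<close> set containing \<open>x\<close> and \<open>b\<close> the first bit of \<open>x\<close>. There are uniformly
  computable clopen sets \<open>base n\<close> of measure exactly \<open>2\<^sup>-\<^sup>n\<close> that decrease from the whole space and
  all contain the tails \<open>y\<close> of the points \<open>b y\<close> of \<open>P\<close>. Build a skyscraper of total measure 1 above
  the cylinder \<open>[b]\<close> whose floor of height \<open>n\<close> is a copy of \<open>base n\<close>, realized as the cylinder of
  the string of \<open>n\<close> entries \<open>\<not> b\<close> followed by \<open>b\<close>. The transformation moves up one floor as long as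
  possible and then returns to the bottom by the odometer. It is ergodic because the map it induces
  on \<open>[b]\<close> is the odometer almost everywhere, whereas the points of \<open>P\<close> in \<open>[b]\<close> climb forever.
\<close>

text \<open>The obstacle is the exact measure of \<open>base n\<close>. The null class is known only
  through clopen supersets whose measures tend to 0 at no given rate. Nullity guarantees that the
  search for a stage of measure at most 2^-n ends, and \<open>level n\<close> is the least such
  stage, but the superset found there must still be filled up with strings that are already covered.
  Careless filling would destroy the inclusion of \<open>base (Suc n)\<close> in
  \<open>base n\<close>; taking the strings with the latest cover time avoids this. Exactness pays
  off because a permutation of the strings of one length can then carry \<open>base n\<close> onto
  the cylinder of n ones. Replacing these ones by the prefix of floor n makes each floor a full
  cylinder of measure 2^-(n+1), and these measures add up to 1. Permutations of prefixes are
  computable, invertible and measure preserving, so T inherits these properties floor by floor. Only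
  the constant sequence \<open>\<not> b\<close> lies on no floor. The points that climb forever form
  a null set, so it is harmless that the odometer image of their feet is not reached by any
  return.\<close>

section \<open>Recursive functions and decidable predicates\<close>

text \<open>
  Predicates and functions of several arguments are encoded by their dependence on a single
  environment \<open>e\<close>, of which each variable is an iterated projection; this lets the closure rules
  below be applied by \<open>intro\<close>.
\<close>

definition pfst :: "nat \<Rightarrow> nat" where "pfst n = fst (prod_decode n)"
definition psnd :: "nat \<Rightarrow> nat" where "psnd n = snd (prod_decode n)"

lemma pfst_encode [simp]: "pfst (prod_encode (a, b)) = a"
  and psnd_encode [simp]: "psnd (prod_encode (a, b)) = b"
  by (simp_all add: pfst_def psnd_def)

lemma prod_encode_pfst_psnd [simp]: "prod_encode (pfst n, psnd n) = n"
  by (simp add: pfst_def psnd_def)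

lemma recursive_const: "recursive_fun (\<lambda>_. k)"
proof (induction k)
  case (Suc k)
  from recursive_fun.comp[OF recursive_fun.succ this] show ?case by simp
qed (rule recursive_fun.zero)

lemma recursive_id: "recursive_fun (\<lambda>n. n)"
  using recursive_fun.pair[OF recursive_fun.left recursive_fun.right] by simp

lemma recursive_pfst: "recursive_fun f \<Longrightarrow> recursive_fun (\<lambda>e. pfst (f e))"
  unfolding pfst_def by (rule recursive_fun.comp[OF recursive_fun.left])

lemma recursive_psnd: "recursive_fun f \<Longrightarrow> recursive_fun (\<lambda>e. psnd (f e))"
  unfolding psnd_def by (rule recursive_fun.comp[OF recursive_fun.right])

lemma recursive_Suc: "recursive_fun f \<Longrightarrow> recursive_fun (\<lambda>e. Suc (f e))"
  by (rule recursive_fun.comp[OF recursive_fun.succ])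

lemma recursive_comp2:
  assumes "recursive_fun (\<lambda>p. h (pfst p) (psnd p))" "recursive_fun f" "recursive_fun g"
  shows "recursive_fun (\<lambda>e. h (f e) (g e))"
  using recursive_fun.comp[OF assms(1) recursive_fun.pair[OF assms(2,3)]] by simp

lemma recursive_comp3:
  assumes "recursive_fun (\<lambda>p. h (pfst p) (pfst (psnd p)) (psnd (psnd p)))"
    "recursive_fun f" "recursive_fun g" "recursive_fun k"
  shows "recursive_fun (\<lambda>e. h (f e) (g e) (k e))"
  using recursive_fun.comp[OF assms(1) recursive_fun.pair[OF assms(2) recursive_fun.pair[OF assms(3,4)]]]
  by simp

text \<open>The whole environment is the parameter of the recursion, so the step may refer to every
  variable in scope.\<close>

lemma recursive_rec_nat:
  assumes "recursive_fun f"
    and "recursive_fun (\<lambda>p. g (pfst p) (pfst (psnd p)) (psnd (psnd p)))"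
    and "recursive_fun m"
  shows "recursive_fun (\<lambda>e. rec_nat (f e) (g e) (m e))"
  using recursive_fun.comp[OF recursive_fun.prim_rec[OF assms(1,2)]
      recursive_fun.pair[OF recursive_id assms(3)]]
  by simp

lemmas recursive_basic = recursive_const recursive_id recursive_pfst recursive_psnd recursive_Suc

lemma recursive_add:
  assumes "recursive_fun f" "recursive_fun g"
  shows "recursive_fun (\<lambda>e. f e + g e)"
proof -
  have "a + b = rec_nat a (\<lambda>_ r. Suc r) b" for a b :: nat
    by (induction b) auto
  then show ?thesis
    by (simp only:) (intro recursive_rec_nat recursive_basic assms)
qed

lemma recursive_mult:
  assumes "recursive_fun f" "recursive_fun g"
  shows "recursive_fun (\<lambda>e. f e * g e)"
proof -
  have "a * b = rec_nat 0 (\<lambda>_ r. r + a) b" for a b :: nat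
    by (induction b) auto
  then show ?thesis
    by (simp only:) (intro recursive_rec_nat recursive_basic recursive_add
        recursive_fun.comp[OF assms(1)] assms)
qed

lemma recursive_power2:
  assumes "recursive_fun f"
  shows "recursive_fun (\<lambda>e. 2 ^ f e)"
proof -
  have "(2 :: nat) ^ b = rec_nat 1 (\<lambda>_ r. r * 2) b" for b
    by (induction b) auto
  then show ?thesis
    by (simp only:) (intro recursive_rec_nat recursive_basic recursive_mult assms)
qed

lemma recursive_diff:
  assumes "recursive_fun f" "recursive_fun g"
  shows "recursive_fun (\<lambda>e. f e - g e)"
proof -
  have pred: "recursive_fun (\<lambda>e. k e - 1)" if "recursive_fun k" for k
  proof -
    have "a - 1 = rec_nat 0 (\<lambda>i _. i) a" for a :: nat
      by (induction a) auto
    then show ?thesis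
      by (simp only:) (intro recursive_rec_nat recursive_basic that)
  qed
  have "rec_nat a (\<lambda>_ r. r - 1) b = a - b" for a b :: nat
    by (induction b) auto
  moreover have "recursive_fun (\<lambda>e. rec_nat (f e) (\<lambda>_ r. r - 1) (g e))"
    by (intro recursive_rec_nat recursive_basic pred assms)
  ultimately show ?thesis
    by (simp only:)
qed

lemma recursive_sum:
  assumes "recursive_fun (\<lambda>p. g (pfst p) (psnd p))" "recursive_fun m"
  shows "recursive_fun (\<lambda>e. \<Sum>i<m e. g e i)"
proof -
  have "(\<Sum>i<m e. g e i) = rec_nat 0 (\<lambda>i r. r + g e i) (m e)" for e
  proof -
    have "(\<Sum>i<b. g e i) = rec_nat 0 (\<lambda>i r. r + g e i) b" for b
      by (induction b) auto
    then show ?thesis .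
  qed
  then show ?thesis
    by (simp only:)
       (intro recursive_rec_nat recursive_basic recursive_add recursive_comp2[OF assms(1)] assms)
qed

section \<open>Decidable predicates and their closure properties\<close>

definition decidable :: "(nat \<Rightarrow> bool) \<Rightarrow> bool" where
  "decidable P \<longleftrightarrow> recursive_fun (\<lambda>e. of_bool (P e))"

lemma recursive_of_bool: "decidable P \<Longrightarrow> recursive_fun (\<lambda>e. of_bool (P e))"
  by (simp add: decidable_def)

lemma decidable_comp: "decidable P \<Longrightarrow> recursive_fun f \<Longrightarrow> decidable (\<lambda>e. P (f e))"
  unfolding decidable_def by (rule recursive_fun.comp)

lemma decidable_comp2:
  assumes "decidable (\<lambda>p. P (pfst p) (psnd p))" "recursive_fun f" "recursive_fun g"
  shows "decidable (\<lambda>e. P (f e) (g e))"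
  using recursive_comp2[OF assms(1)[unfolded decidable_def] assms(2,3)] by (simp add: decidable_def)

lemma decidable_comp3:
  assumes "decidable (\<lambda>p. P (pfst p) (pfst (psnd p)) (psnd (psnd p)))"
    "recursive_fun f" "recursive_fun g" "recursive_fun k"
  shows "decidable (\<lambda>e. P (f e) (g e) (k e))"
  using recursive_comp3[OF assms(1)[unfolded decidable_def] assms(2-4)] by (simp add: decidable_def)

lemma decidable_const: "decidable (\<lambda>_. b)"
  unfolding decidable_def by (rule recursive_const)

lemma decidable_le:
  assumes "recursive_fun f" "recursive_fun g"
  shows "decidable (\<lambda>e. f e \<le> g e)"
proof -
  have "of_bool (a \<le> b) = 1 - (a - b)" for a b :: nat
    by auto
  then show ?thesis
    unfolding decidable_def by (simp only:) (intro recursive_diff recursive_const assms)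
qed

lemma decidable_not:
  assumes "decidable P"
  shows "decidable (\<lambda>e. \<not> P e)"
proof -
  have "of_bool (\<not> b) = 1 - (of_bool b :: nat)" for b
    by auto
  then show ?thesis
    unfolding decidable_def by (simp only:) (intro recursive_diff recursive_const recursive_of_bool assms)
qed

lemma decidable_conj:
  assumes "decidable P" "decidable Q"
  shows "decidable (\<lambda>e. P e \<and> Q e)"
proof -
  have "of_bool (b \<and> c) = (of_bool b * of_bool c :: nat)" for b c
    by auto
  then show ?thesis
    unfolding decidable_def by (simp only:) (intro recursive_mult recursive_of_bool assms)
qed

lemma decidable_disj:
  assumes "decidable P" "decidable Q"
  shows "decidable (\<lambda>e. P e \<or> Q e)"
proof -
  have "(b \<or> c) = (\<not> (\<not> b \<and> \<not> c))" for b c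
    by auto
  then show ?thesis
    by (simp only:) (intro decidable_not decidable_conj assms)
qed

lemma decidable_imp:
  assumes "decidable P" "decidable Q"
  shows "decidable (\<lambda>e. P e \<longrightarrow> Q e)"
  unfolding imp_conv_disj by (intro decidable_disj decidable_not assms)

lemma decidable_iff:
  assumes "decidable P" "decidable Q"
  shows "decidable (\<lambda>e. P e \<longleftrightarrow> Q e)"
  unfolding iff_conv_conj_imp by (intro decidable_conj decidable_imp assms)

lemma decidable_less:
  assumes "recursive_fun f" "recursive_fun g"
  shows "decidable (\<lambda>e. f e < g e)"
  unfolding less_eq_Suc_le by (intro decidable_le recursive_Suc assms)

lemma decidable_eq:
  assumes "recursive_fun f" "recursive_fun g"
  shows "decidable (\<lambda>e. f e = g e)"
  unfolding eq_iff[of "_::nat"] by (intro decidable_conj decidable_le assms)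

lemma decidable_ex_less:
  assumes "decidable (\<lambda>p. P (pfst p) (psnd p))" "recursive_fun m"
  shows "decidable (\<lambda>e. \<exists>i<m e. P e i)"
proof -
  have "(\<exists>i<b. Q i) \<longleftrightarrow> 0 < (\<Sum>i<b. of_bool (Q i) :: nat)" for b :: nat and Q
    by (auto simp: sum_nonneg_eq_0_iff zero_less_iff_neq_zero simp del: neq0_conv)
  then show ?thesis
    by (simp only:) (intro decidable_less recursive_const recursive_sum recursive_of_bool assms)
qed

lemma decidable_all_less:
  assumes "decidable (\<lambda>p. P (pfst p) (psnd p))" "recursive_fun m"
  shows "decidable (\<lambda>e. \<forall>i<m e. P e i)"
proof -
  have "(\<forall>i<b. Q i) = (\<not> (\<exists>i<b. \<not> Q i))" for b :: nat and Q
    by auto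
  then show ?thesis
    by (simp only:) (intro decidable_not decidable_ex_less assms)
qed

lemma recursive_if:
  assumes "decidable P" "recursive_fun f" "recursive_fun g"
  shows "recursive_fun (\<lambda>e. if P e then f e else g e)"
proof -
  have "(if b then x else y) = of_bool b * x + of_bool (\<not> b) * y" for b and x y :: nat
    by auto
  then show ?thesis
    by (simp only:)
       (intro recursive_add recursive_mult recursive_of_bool decidable_not assms)
qed

lemma decidable_if:
  assumes "decidable P" "decidable Q" "decidable R"
  shows "decidable (\<lambda>e. if P e then Q e else R e)"
  unfolding if_bool_eq_conj by (intro decidable_conj decidable_imp decidable_not assms)

lemma recursive_LEAST:
  assumes "decidable (\<lambda>p. P (pfst p) (psnd p))" "\<And>e. \<exists>i. P e i"
  shows "recursive_fun (\<lambda>e. LEAST i. P e i)"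
proof -
  have "recursive_fun (\<lambda>e. LEAST i. of_bool (\<not> P (pfst (prod_encode (e, i))) (psnd (prod_encode (e, i)))) = (0::nat))"
    by (rule recursive_fun.minimization) (use assms decidable_not decidable_def in auto)
  then show ?thesis
    by simp
qed

text \<open>The quotient is the least q with \<open>f e < Suc q * g e\<close>; positivity of the
  divisor makes this search succeed everywhere.\<close>

lemma recursive_div:
  assumes "recursive_fun f" "recursive_fun g" "\<And>e. g e > 0"
  shows "recursive_fun (\<lambda>e. f e div g e)"
proof -
  have "f e div g e = (LEAST q. f e < Suc q * g e)" for e
    using assms(3)[of e]
    by (intro Least_equality[symmetric])
       (simp_all only: div_less_iff_less_mult[symmetric] less_Suc_eq_le order_refl)
  moreover have "\<exists>q. f e < Suc q * g e" for e
    using assms(3)[of e] by (intro exI[of _ "f e"]) (cases "g e", auto)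
  ultimately show ?thesis
    by (simp only:) (intro recursive_LEAST decidable_less recursive_mult recursive_basic
        recursive_fun.comp[OF assms(1)] recursive_fun.comp[OF assms(2)])
qed

lemma decidable_odd:
  assumes "recursive_fun f"
  shows "decidable (\<lambda>e. odd (f e))"
proof -
  have "odd a \<longleftrightarrow> a \<noteq> 2 * (a div 2)" for a :: nat
    by presburger
  then show ?thesis
    by (simp only:) (intro decidable_not decidable_eq recursive_mult recursive_div recursive_const assms, simp)
qed

section \<open>Codes of lists of numbers\<close>

definition code_drop :: "nat \<Rightarrow> nat \<Rightarrow> nat" where
  "code_drop c i = rec_nat c (\<lambda>_ r. psnd (r - 1)) i"

definition code_nth :: "nat \<Rightarrow> nat \<Rightarrow> nat" where
  "code_nth c i = pfst (code_drop c i - 1)"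

definition code_length :: "nat \<Rightarrow> nat" where
  "code_length c = (LEAST i. code_drop c i = 0)"

lemma pfst_psnd_0 [simp]: "pfst 0 = 0" "psnd 0 = 0"
proof -
  have "prod_encode (0, 0) = 0"
    by (simp add: prod_encode_def)
  then show "pfst 0 = 0" "psnd 0 = 0"
    by (metis pfst_encode, metis psnd_encode)
qed

text \<open>The code of a nonempty list is the successor of the pair of its head and the code of its
  tail, so \<open>psnd (r - 1)\<close> takes the tail. The empty list has code 0, which this
  operation fixes because \<open>psnd 0 = 0\<close>.\<close>

lemma code_drop_list_encode: "code_drop (list_encode xs) i = list_encode (drop i xs)"
proof (induction i)
  case (Suc i)
  have "code_drop (list_encode xs) (Suc i) = psnd (list_encode (drop i xs) - 1)"
    using Suc by (simp add: code_drop_def)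
  also have "\<dots> = list_encode (tl (drop i xs))"
    by (cases "drop i xs") auto
  finally show ?case
    by (simp add: tl_drop drop_Suc)
qed (simp add: code_drop_def)

lemma code_nth_list_encode:
  "code_nth (list_encode xs) i = (if i < length xs then xs ! i else 0)"
proof (cases "i < length xs")
  case True
  then show ?thesis
    by (simp add: code_nth_def code_drop_list_encode Cons_nth_drop_Suc[symmetric])
qed (simp add: code_nth_def code_drop_list_encode)

lemma list_encode_eq_0_iff: "list_encode xs = 0 \<longleftrightarrow> xs = []"
  by (cases xs) auto

lemma code_length_list_encode: "code_length (list_encode xs) = length xs"
  unfolding code_length_def code_drop_list_encode list_encode_eq_0_iff
  by (rule Least_equality) auto

lemma recursive_code_drop:
  assumes "recursive_fun f" "recursive_fun g"
  shows "recursive_fun (\<lambda>e. code_drop (f e) (g e))"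
  unfolding code_drop_def
  by (intro recursive_rec_nat recursive_diff recursive_basic assms)

lemma recursive_code_nth:
  assumes "recursive_fun f" "recursive_fun g"
  shows "recursive_fun (\<lambda>e. code_nth (f e) (g e))"
  unfolding code_nth_def
  by (intro recursive_code_drop recursive_diff recursive_basic assms)

lemma recursive_code_length:
  assumes "recursive_fun f"
  shows "recursive_fun (\<lambda>e. code_length (f e))"
proof -
  have "\<exists>i. code_drop c i = 0" for c
    using code_drop_list_encode[of "list_decode c" "length (list_decode c)"] by auto
  then have "recursive_fun code_length"
    unfolding code_length_def
    by (intro recursive_LEAST decidable_eq recursive_code_drop recursive_basic)
  then show ?thesis
    using assms by (rule recursive_fun.comp)
qed

lemmas recursive_intros = recursive_basic recursive_add recursive_mult recursive_power2
  recursive_diff recursive_sum recursive_of_bool recursive_if recursive_code_nth recursive_code_length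
  decidable_const decidable_le decidable_less decidable_eq decidable_not decidable_conj
  decidable_disj decidable_imp decidable_iff decidable_if decidable_odd
  decidable_ex_less decidable_all_less

section \<open>Enumerability by projection\<close>

lemma ce_projection:
  assumes "decidable (\<lambda>p. D (pfst p) (psnd p))"
  shows "ce {n. \<exists>c. D n c}"
proof (cases "{n. \<exists>c. D n c} = {}")
  case False
  then obtain s c where s: "D s c"
    by auto
  \<comment> \<open>The enumeration runs through all pairs of a candidate and a witness. It has to
    be total, so failing pairs are sent to the fixed member s.\<close>
  have "recursive_fun (\<lambda>p. if D (pfst p) (psnd p) then pfst p else s)"
    by (intro recursive_intros assms)
  moreover have "{n. \<exists>c. D n c} = range (\<lambda>p. if D (pfst p) (psnd p) then pfst p else s)"
  proof (intro equalityI subsetI)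
    fix n assume "n \<in> {n. \<exists>c. D n c}"
    then obtain c where "D n c"
      by auto
    then show "n \<in> range (\<lambda>p. if D (pfst p) (psnd p) then pfst p else s)"
      by (intro range_eqI[of _ _ "prod_encode (n, c)"]) simp
  qed (use s in \<open>auto split: if_splits\<close>)
  ultimately show ?thesis
    unfolding ce_def by (intro disjI2 exI conjI)
qed (simp add: ce_def)

definition is_string :: "nat \<Rightarrow> bool" where
  "is_string c \<longleftrightarrow> (\<forall>i<code_length c. code_nth c i \<le> 1)"

text \<open>Entries beyond the end of the coded string are \<^const>\<open>False\<close>.\<close>

definition code_seq :: "nat \<Rightarrow> cantor" where
  "code_seq c = (\<lambda>i. code_nth c i = 1)"

lemma code_length_string_code [simp]: "code_length (string_code \<sigma>) = length \<sigma>"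
  by (simp add: string_code_def code_length_list_encode)

lemma code_seq_string_code: "i < length \<sigma> \<Longrightarrow> code_seq (string_code \<sigma>) i = \<sigma> ! i"
  by (simp add: code_seq_def string_code_def code_nth_list_encode)

lemma is_string_iff: "is_string c \<longleftrightarrow> c \<in> range string_code"
proof
  assume c: "is_string c"
  define xs where "xs = list_decode c"
  have c_eq: "c = list_encode xs"
    by (simp add: xs_def)
  have "map of_bool (map (\<lambda>x. x = 1) xs) = xs"
    using c by (intro nth_equalityI)
      (auto simp: is_string_def c_eq code_length_list_encode code_nth_list_encode le_Suc_eq)
  then have "c = string_code (map (\<lambda>x. x = 1) xs)"
    by (simp add: string_code_def c_eq)
  then show "c \<in> range string_code"
    by blast
qed (auto simp: is_string_def string_code_def code_length_list_encode code_nth_list_encode)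

lemma decidable_is_string: "recursive_fun f \<Longrightarrow> decidable (\<lambda>e. is_string (f e))"
proof (rule decidable_comp)
  show "decidable is_string"
    unfolding is_string_def by (intro recursive_intros)
qed

lemma decidable_code_seq:
  "recursive_fun f \<Longrightarrow> recursive_fun g \<Longrightarrow> decidable (\<lambda>e. code_seq (f e) (g e))"
  unfolding code_seq_def by (intro recursive_intros)

text \<open>\<open>D\<close> need only be correct on codes of strings: the decidable test
  \<open>is_string\<close> filters out all other numbers.\<close>

lemma ce_stringsI:
  assumes "decidable (\<lambda>p. D (pfst p) (psnd p))"
    and "\<And>\<sigma>. \<sigma> \<in> W \<longleftrightarrow> (\<exists>c. D (string_code \<sigma>) c)"
  shows "ce_strings W"
proof -
  have "string_code ` W = {n. \<exists>c. is_string n \<and> D n c}"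
    using assms(2) by (auto simp: is_string_iff)
  then show ?thesis
    unfolding ce_strings_def
    by (simp only:) (intro ce_projection decidable_conj decidable_is_string recursive_basic assms)
qed

lemma ce_string_pairsI:
  assumes "decidable (\<lambda>p. D (pfst p) (pfst (psnd p)) (psnd (psnd p)))"
    and "\<And>\<sigma> \<tau>. (\<sigma>, \<tau>) \<in> W \<longleftrightarrow> (\<exists>c. D (string_code \<sigma>) (string_code \<tau>) c)"
  shows "ce_string_pairs W"
proof -
  have "(\<lambda>(\<sigma>, \<tau>). prod_encode (string_code \<sigma>, string_code \<tau>)) ` W =
      {n. \<exists>c. is_string (pfst n) \<and> is_string (psnd n) \<and> D (pfst n) (psnd n) c}"
  proof (intro equalityI subsetI)
    fix n assume "n \<in> {n. \<exists>c. is_string (pfst n) \<and> is_string (psnd n) \<and> D (pfst n) (psnd n) c}"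
    then obtain \<sigma> \<tau> c where *: "pfst n = string_code \<sigma>" "psnd n = string_code \<tau>" "D (pfst n) (psnd n) c"
      by (auto simp: is_string_iff)
    then have "n = prod_encode (string_code \<sigma>, string_code \<tau>)" "(\<sigma>, \<tau>) \<in> W"
      using assms(2) by (metis prod_encode_pfst_psnd, metis)
    then show "n \<in> (\<lambda>(\<sigma>, \<tau>). prod_encode (string_code \<sigma>, string_code \<tau>)) ` W"
      by force
  next
    fix n assume "n \<in> (\<lambda>(\<sigma>, \<tau>). prod_encode (string_code \<sigma>, string_code \<tau>)) ` W"
    then obtain \<sigma> \<tau> where "(\<sigma>, \<tau>) \<in> W" "n = prod_encode (string_code \<sigma>, string_code \<tau>)"
      by auto
    then show "n \<in> {n. \<exists>c. is_string (pfst n) \<and> is_string (psnd n) \<and> D (pfst n) (psnd n) c}"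
      using assms(2) by (simp add: is_string_iff)
  qed
  \<comment> \<open>The projection is applied to a number n that is itself a pair, so the triple has
    to be regrouped as ((s, t), c).\<close>
  moreover have "decidable (\<lambda>p. D (pfst (pfst p)) (psnd (pfst p)) (psnd p))"
    unfolding decidable_def
    by (rule recursive_comp3[OF assms(1)[unfolded decidable_def]]; intro recursive_basic)
  ultimately show ?thesis
    unfolding ce_string_pairs_def
    by (simp only:) (intro ce_projection decidable_conj decidable_is_string recursive_basic)
qed

section \<open>Prefix bijections and the odometer\<close>

lemma space_cantor_measure [simp]: "space cantor_measure = UNIV"
  using sets_eq_imp_space_eq[OF sets_cantor_measure] by simp

lemma emeasure_cantor_measure_UNIV: "emeasure cantor_measure UNIV = 1"
  using prob_space.emeasure_space_1[OF prob_space_cantor_measure] by simp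

lemma cylinder_Nil [simp]: "cylinder [] = UNIV"
  by (simp add: cylinder_def)

lemma cylinder_borel [measurable]: "cylinder \<sigma> \<in> sets borel"
  by (rule borel_open[OF open_cylinder])

lemma measure_cylinder: "measure cantor_measure (cylinder \<sigma>) = (1/2) ^ length \<sigma>"
proof -
  have "(1/2 :: ennreal) = ennreal (1/2)"
    using divide_ennreal[of 1 2] by simp
  then have "emeasure cantor_measure (cylinder \<sigma>) = ennreal ((1/2) ^ length \<sigma>)"
    by (simp only: emeasure_cylinder) (rule ennreal_power, simp)
  then show ?thesis
    by (simp add: measure_def)
qed

lemma cylinder_eq_agree: "y \<in> cylinder \<sigma> \<Longrightarrow> cylinder \<sigma> = {z. \<forall>i<length \<sigma>. z i = y i}"
  by (auto simp: cylinder_def)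

lemma cylinder_map: "cylinder (map y [0..<M]) = {z. \<forall>i<M. z i = y i}"
  by (simp add: cylinder_def)

lemma UN_cylinder_length: "(\<Union>\<sigma>\<in>{\<sigma>. length \<sigma> = M}. cylinder \<sigma>) = UNIV"
proof -
  have "y \<in> cylinder (map y [0..<M])" for y
    by (simp add: cylinder_map)
  then show ?thesis
    by (metis (mono_tags, lifting) UNIV_eq_I UN_I diff_zero length_map length_upt mem_Collect_eq)
qed

lemma disjoint_cylinder_length: "disjoint_family_on cylinder {\<sigma>. length \<sigma> = M}"
  unfolding disjoint_family_on_def
proof (intro ballI impI, rule ccontr)
  fix \<sigma> \<tau> assume *: "\<sigma> \<in> {\<sigma>. length \<sigma> = M}" "\<tau> \<in> {\<sigma>. length \<sigma> = M}" "\<sigma> \<noteq> \<tau>"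
    and "cylinder \<sigma> \<inter> cylinder \<tau> \<noteq> {}"
  then obtain y where y: "y \<in> cylinder \<sigma>" "y \<in> cylinder \<tau>"
    by blast
  have "\<sigma> = \<tau>"
  proof (rule nth_equalityI)
    show "length \<sigma> = length \<tau>"
      using * by simp
    show "\<sigma> ! i = \<tau> ! i" if "i < length \<sigma>" for i
      using y * that by (simp add: cylinder_def)
  qed
  with * show False
    by simp
qed

lemma finite_bool_lists_length: "finite {\<sigma> :: bool list. length \<sigma> = M}"
  using finite_lists_length_eq[of "UNIV :: bool set" M] by simp

lemma card_bool_lists_length: "card {\<sigma> :: bool list. length \<sigma> = M} = 2 ^ M"
  using card_lists_length_eq[of "UNIV :: bool set" M] by simp

lemma emeasure_cylinder_split:
  assumes "sets M = sets borel" "B \<in> sets borel"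
  shows "emeasure M B = (\<Sum>\<sigma> | length \<sigma> = m. emeasure M (B \<inter> cylinder \<sigma>))"
proof -
  have "(\<Sum>\<sigma> | length \<sigma> = m. emeasure M (B \<inter> cylinder \<sigma>)) = emeasure M (\<Union>\<sigma>\<in>{\<sigma>. length \<sigma> = m}. B \<inter> cylinder \<sigma>)"
    by (rule sum_emeasure)
       (use assms disjoint_cylinder_length[of m] finite_bool_lists_length in
         \<open>auto simp: disjoint_family_on_def\<close>)
  also have "(\<Union>\<sigma>\<in>{\<sigma>. length \<sigma> = m}. B \<inter> cylinder \<sigma>) = B"
    by (simp only: Int_UN_distrib[symmetric] UN_cylinder_length Int_UNIV_right)
  finally show ?thesis ..
qed

lemma sets_borel_cantor: "sets (borel :: cantor measure) = sigma_sets UNIV (insert {} (range cylinder))"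
proof (intro equalityI)
  have "U \<in> sigma_sets UNIV (insert {} (range cylinder))" if U: "open U" for U :: "cantor set"
  proof -
    obtain W where "U = (\<Union>\<sigma>\<in>W. cylinder \<sigma>)"
      using U open_iff_Union_cylinder by blast
    then show ?thesis
      by (auto intro!: sigma_sets_UNION countable_image intro: sigma_sets.Basic)
  qed
  then show "sets borel \<subseteq> sigma_sets UNIV (insert {} (range cylinder))"
    unfolding borel_def by (auto intro!: sigma_sets_mono simp: sets_measure_of)
  show "sigma_sets UNIV (insert {} (range cylinder)) \<subseteq> sets borel"
    by (rule sets.sigma_sets_subset[where M = borel, simplified]) auto
qed

text \<open>Cylinders generate the Borel sets and are closed under intersection up to the empty set.
  Only long cylinders are tested because a prefix bijection is controlled only on prefixes of length
  at least m.\<close>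

lemma measure_eqI_cylinder:
  fixes M N :: "cantor measure"
  assumes sets: "sets M = sets borel" "sets N = sets borel"
    and fin: "emeasure M UNIV \<noteq> \<infinity>"
    and eq: "\<And>\<sigma>. m \<le> length \<sigma> \<Longrightarrow> emeasure M (cylinder \<sigma>) = emeasure N (cylinder \<sigma>)"
  shows "M = N"
proof (rule measure_eqI_generator_eq[where E = "insert {} (range cylinder)" and \<Omega> = UNIV and A = "\<lambda>_. UNIV"])
  have inter: "cylinder \<sigma> \<inter> cylinder \<tau> \<in> {{}, cylinder \<sigma>, cylinder \<tau>}" for \<sigma> \<tau>
  proof (cases "cylinder \<sigma> \<inter> cylinder \<tau> = {}")
    case False
    then obtain y where y: "y \<in> cylinder \<sigma>" "y \<in> cylinder \<tau>"
      by blast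
    show ?thesis
      unfolding cylinder_eq_agree[OF y(1)] cylinder_eq_agree[OF y(2)]
      by (cases "length \<sigma> \<le> length \<tau>") auto
  qed simp
  show "Int_stable (insert {} (range cylinder))"
  proof (unfold Int_stable_def, intro ballI)
    fix X Y :: "cantor set" assume "X \<in> insert {} (range cylinder)" "Y \<in> insert {} (range cylinder)"
    then consider "X \<inter> Y = {}" | \<sigma> \<tau> where "X = cylinder \<sigma>" "Y = cylinder \<tau>"
      by blast
    then show "X \<inter> Y \<in> insert {} (range cylinder)"
    proof cases
      case 2
      then show ?thesis
        using inter[of \<sigma> \<tau>] by (elim insertE) simp_all
    qed simp
  qed
  fix X :: "cantor set" assume "X \<in> insert {} (range cylinder)"
  then consider "X = {}" | \<sigma> where "X = cylinder \<sigma>"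
    by auto
  then show "emeasure M X = emeasure N X"
  proof cases
    case 2
    \<comment> \<open>Pieces of this length are long enough for \<open>eq\<close> and refine
      \<open>cylinder \<sigma>\<close>: each is either contained in it or disjoint from it.\<close>
    have "emeasure K X = (\<Sum>\<tau> | length \<tau> = m + length \<sigma>. emeasure K (cylinder \<sigma> \<inter> cylinder \<tau>))"
      if "sets K = sets borel" for K
      unfolding 2 by (rule emeasure_cylinder_split[OF that]) simp
    moreover have "emeasure M (cylinder \<sigma> \<inter> cylinder \<tau>) = emeasure N (cylinder \<sigma> \<inter> cylinder \<tau>)"
      if "length \<tau> = m + length \<sigma>" for \<tau>
    proof (cases "cylinder \<sigma> \<inter> cylinder \<tau> = {}")
      case False
      then obtain y where y: "y \<in> cylinder \<sigma>" "y \<in> cylinder \<tau>"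
        by blast
      have "cylinder \<sigma> \<inter> cylinder \<tau> = cylinder \<tau>"
        unfolding cylinder_eq_agree[OF y(1)] cylinder_eq_agree[OF y(2)] using that by auto
      then show ?thesis
        using eq[of \<tau>] that by simp
    qed simp
    ultimately show ?thesis
      using sets by simp
  qed simp
next
  show "range (\<lambda>_. UNIV :: cantor set) \<subseteq> insert {} (range cylinder)"
    by (auto intro!: rev_image_eqI[of "[]"])
qed (use sets fin sets_borel_cantor in auto)

lemma measurable_cantor_shift [measurable]: "(\<lambda>z :: cantor. \<lambda>i. z (i + k)) \<in> borel \<rightarrow>\<^sub>M borel"
  by (intro measurable_coordinatewise_then_product measurable_product_coordinates)

text \<open>Given its prefix, a random point has a tail that is again distributed by \<lambda>. On
  cylinders this holds because prefixing \<sigma> to the cylinder of \<tau> yields the cylinder of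
  \<open>\<sigma> @ \<tau>\<close>.\<close>

lemma emeasure_cylinder_shift:
  assumes "C \<in> sets borel"
  shows "emeasure cantor_measure {z \<in> cylinder \<sigma>. (\<lambda>i. z (i + length \<sigma>)) \<in> C} =
    (1/2) ^ length \<sigma> * emeasure cantor_measure C"
proof -
  note sets_cantor_measure [measurable_cong]
  let ?s = "\<lambda>z :: cantor. \<lambda>i. z (i + length \<sigma>)"
  let ?M = "distr (density cantor_measure (indicator (cylinder \<sigma>))) borel ?s"
  let ?N = "scale_measure ((1/2) ^ length \<sigma>) cantor_measure"
  have s: "?s \<in> cantor_measure \<rightarrow>\<^sub>M borel"
    by measurable
  have M: "emeasure ?M B = emeasure cantor_measure {z \<in> cylinder \<sigma>. ?s z \<in> B}" if "B \<in> sets borel" for B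
  proof -
    have "emeasure ?M B = emeasure (density cantor_measure (indicator (cylinder \<sigma>))) (?s -` B)"
      using s that by (subst emeasure_distr) auto
    also have "\<dots> = emeasure cantor_measure (cylinder \<sigma> \<inter> ?s -` B)"
      using measurable_sets[OF s that] by (intro emeasure_restricted) (auto simp: sets_cantor_measure)
    finally show ?thesis
      by (simp add: vimage_def Int_def)
  qed
  have "?M = ?N"
  proof (rule measure_eqI_cylinder[where m = 0])
    show "emeasure ?M UNIV \<noteq> \<infinity>"
      by (subst M) (auto simp: emeasure_cylinder power_eq_top_ennreal ennreal_divide_eq_top_iff)
    fix \<tau>
    have "{z \<in> cylinder \<sigma>. ?s z \<in> cylinder \<tau>} = cylinder (\<sigma> @ \<tau>)"
    proof (intro equalityI subsetI)
      fix z assume "z \<in> cylinder (\<sigma> @ \<tau>)"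
      then have z: "z i = (\<sigma> @ \<tau>) ! i" if "i < length \<sigma> + length \<tau>" for i
        using that by (simp add: cylinder_def)
      show "z \<in> {z \<in> cylinder \<sigma>. ?s z \<in> cylinder \<tau>}"
        by (simp add: cylinder_def z nth_append)
    next
      fix z assume z: "z \<in> {z \<in> cylinder \<sigma>. ?s z \<in> cylinder \<tau>}"
      have "z i = (\<sigma> @ \<tau>) ! i" if "i < length \<sigma> + length \<tau>" for i
      proof (cases "i < length \<sigma>")
        case True
        then show ?thesis
          using z by (simp add: cylinder_def nth_append)
      next
        case False
        have "\<forall>j<length \<tau>. z (j + length \<sigma>) = \<tau> ! j"
          using z by (simp add: cylinder_def)
        from this[rule_format, of "i - length \<sigma>"] show ?thesis
          using False that by (simp add: nth_append)
      qed
      then show "z \<in> cylinder (\<sigma> @ \<tau>)"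
        by (simp add: cylinder_def)
    qed
    then show "emeasure ?M (cylinder \<tau>) = emeasure ?N (cylinder \<tau>)"
      by (simp add: M emeasure_cylinder power_add)
  qed (auto simp: sets_cantor_measure)
  then show ?thesis
    using M[OF assms] assms by simp
qed

text \<open>Such a map permutes the strings of every length M at or above m, so it is a
  measure-preserving homeomorphism. Any such M also bounds the information flow in both directions:
  M bits of the argument and M bits of the value determine each other.\<close>

definition prefix_bijection :: "nat \<Rightarrow> (cantor \<Rightarrow> cantor) \<Rightarrow> bool" where
  "prefix_bijection m g \<longleftrightarrow> surj g \<and>
     (\<forall>M\<ge>m. \<forall>y z. (\<forall>i<M. g y i = g z i) \<longleftrightarrow> (\<forall>i<M. y i = z i))"

lemma prefix_bijection_agree:
  "prefix_bijection m g \<Longrightarrow> m \<le> M \<Longrightarrow> (\<forall>i<M. g y i = g z i) \<longleftrightarrow> (\<forall>i<M. y i = z i)"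
  by (simp add: prefix_bijection_def)

lemma prefix_bijection_bij:
  assumes "prefix_bijection m g"
  shows "bij g"
proof (rule bijI)
  show "inj g"
  proof (rule injI)
    fix y z assume eq: "g y = g z"
    show "y = z"
    proof
      fix i
      show "y i = z i"
        using prefix_bijection_agree[OF assms, of "m + Suc i" y z, THEN iffD1, rule_format, of i] eq
        by simp
    qed
  qed
qed (use assms in \<open>simp add: prefix_bijection_def\<close>)

lemma prefix_bijection_inv:
  assumes "prefix_bijection m g"
  shows "prefix_bijection m (inv g)"
  unfolding prefix_bijection_def
proof (intro conjI allI impI)
  have bij: "bij g"
    using assms by (rule prefix_bijection_bij)
  then show "surj (inv g)"
    by (simp add: bij_imp_bij_inv bij_is_surj)
  fix M y z assume "m \<le> M"
  from prefix_bijection_agree[OF assms this, of "inv g y" "inv g z"]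
  show "(\<forall>i<M. inv g y i = inv g z i) \<longleftrightarrow> (\<forall>i<M. y i = z i)"
    using bij by (simp add: bij_is_surj surj_f_inv_f)
qed

lemma prefix_bijection_vimage:
  assumes "prefix_bijection m g" "m \<le> length \<sigma>"
  obtains \<tau> where "length \<tau> = length \<sigma>" "g -` cylinder \<sigma> = cylinder \<tau>"
proof -
  \<comment> \<open>Padding \<sigma> with \<open>False\<close> gives a point of its cylinder. The
    preimage cylinder is then read off from the first bits of one point mapped to it.\<close>
  let ?p = "\<lambda>i. i < length \<sigma> \<and> \<sigma> ! i"
  obtain y where y: "g y = ?p"
    using assms(1) by (metis prefix_bijection_def surjD)
  then have "g y \<in> cylinder \<sigma>"
    by (simp add: cylinder_def)
  then have "g -` cylinder \<sigma> = cylinder (map y [0..<length \<sigma>])"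
    using prefix_bijection_agree[OF assms] by (simp add: cylinder_eq_agree[OF \<open>g y \<in> _\<close>] cylinder_map set_eq_iff)
  then show ?thesis
    by (intro that[of "map y [0..<length \<sigma>]"]) auto
qed

lemma prefix_bijection_measurable:
  assumes g: "prefix_bijection m g"
  shows "g \<in> borel \<rightarrow>\<^sub>M borel"
proof (rule measurable_coordinatewise_then_product)
  fix i
  \<comment> \<open>The length \<open>m + Suc i\<close> is at least m and large enough to contain
    bit i.\<close>
  have "{y. g y i} = (\<Union>\<sigma>\<in>{\<sigma>. length \<sigma> = m + Suc i \<and> \<sigma> ! i}. g -` cylinder \<sigma>)"
  proof (intro equalityI subsetI)
    fix y assume "y \<in> {y. g y i}"
    then show "y \<in> (\<Union>\<sigma>\<in>{\<sigma>. length \<sigma> = m + Suc i \<and> \<sigma> ! i}. g -` cylinder \<sigma>)"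
      by (intro UN_I[of "map (g y) [0..<m + Suc i]"]) (auto simp: cylinder_map simp del: upt_Suc)
  qed (auto simp: cylinder_def)
  also have "\<dots> \<in> sets borel"
  proof (rule sets.countable_UN'')
    fix \<sigma> :: "bool list" assume "\<sigma> \<in> {\<sigma>. length \<sigma> = m + Suc i \<and> \<sigma> ! i}"
    then have "m \<le> length \<sigma>"
      by simp
    from prefix_bijection_vimage[OF g this] show "g -` cylinder \<sigma> \<in> sets borel"
      by (metis cylinder_borel)
  qed (rule countableI_type)
  finally have sets: "{y. g y i} \<in> sets borel" .
  show "(\<lambda>y. g y i) \<in> borel_measurable borel"
  proof (rule borel_measurableI)
    fix S :: "bool set"
    have "(\<lambda>y. g y i) -` S = (if True \<in> S then {y. g y i} else {}) \<union> (if False \<in> S then - {y. g y i} else {})"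
      by (intro set_eqI, case_tac "g x i") simp_all
    then show "(\<lambda>y. g y i) -` S \<inter> space borel \<in> sets borel"
      using sets by (simp add: borel_comp)
  qed
qed

text \<open>Preimages of long cylinders are cylinders of the same length, and these determine the
  image measure.\<close>

lemma prefix_bijection_emeasure:
  assumes g: "prefix_bijection m g" and B: "B \<in> sets borel"
  shows "emeasure cantor_measure (g -` B) = emeasure cantor_measure B"
proof -
  have meas: "g \<in> cantor_measure \<rightarrow>\<^sub>M borel"
    using prefix_bijection_measurable[OF g] sets_cantor_measure measurable_cong_sets by blast
  have "distr cantor_measure borel g = cantor_measure"
  proof (rule measure_eqI_cylinder[where m = m])
    fix \<sigma> :: "bool list" assume "m \<le> length \<sigma>"
    then show "emeasure (distr cantor_measure borel g) (cylinder \<sigma>) = emeasure cantor_measure (cylinder \<sigma>)"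
      using prefix_bijection_vimage[OF g] meas
      by (metis cylinder_borel emeasure_cylinder emeasure_distr inf_top.right_neutral space_cantor_measure)
  qed (use meas in \<open>auto simp: sets_cantor_measure emeasure_distr emeasure_cantor_measure_UNIV\<close>)
  then show ?thesis
    using emeasure_distr[OF meas B] by simp
qed

section \<open>The odometer and its ergodicity\<close>

definition odometer :: "cantor \<Rightarrow> cantor" where
  "odometer y = (\<lambda>i. y i \<noteq> (\<forall>j<i. y j))"

text \<open>The odometer adds 1 with the least significant bit first: a bit flips exactly when the
  carry passes all earlier ones. Bit i of the value depends only on bits up to i, hence the modulus
  0.\<close>

lemma prefix_bijection_odometer: "prefix_bijection 0 odometer"
  unfolding prefix_bijection_def
proof (intro conjI allI impI)
  show "surj odometer"
  proof (rule surjI)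
    fix z :: cantor
    \<comment> \<open>Subtraction of 1: the borrow reaches bit i when all earlier bits of z are 0,
      which happens exactly when all earlier bits of the difference are 1.\<close>
    let ?y = "\<lambda>i. z i \<noteq> (\<forall>j<i. \<not> z j)"
    have y: "(\<forall>j<i. ?y j) \<longleftrightarrow> (\<forall>j<i. \<not> z j)" for i
    proof (induction i)
      case (Suc i)
      show ?case
        unfolding All_less_Suc Suc by argo
    qed simp
    show "odometer ?y = z"
    proof
      show "odometer ?y i = z i" for i
        unfolding odometer_def y by argo
    qed
  qed
  fix M y z
  show "(\<forall>i<M. odometer y i = odometer z i) = (\<forall>i<M. y i = z i)"
  proof (induction M)
    case (Suc M)
    have "odometer y M = odometer z M \<longleftrightarrow> y M = z M" if "\<forall>i<M. y i = z i"
      using that by (auto simp: odometer_def)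
    then show ?case
      using Suc unfolding All_less_Suc by argo
  qed simp
qed

fun string_odometer :: "bool list \<Rightarrow> bool list" where
  "string_odometer [] = []"
| "string_odometer (True # \<sigma>) = False # string_odometer \<sigma>"
| "string_odometer (False # \<sigma>) = True # \<sigma>"

lemma length_string_odometer [simp]: "length (string_odometer \<sigma>) = length \<sigma>"
  by (induction \<sigma> rule: string_odometer.induct) auto

lemma nth_string_odometer:
  "i < length \<sigma> \<Longrightarrow> string_odometer \<sigma> ! i \<longleftrightarrow> \<sigma> ! i \<noteq> (\<forall>j<i. \<sigma> ! j)"
  by (induction \<sigma> arbitrary: i rule: string_odometer.induct; case_tac i; simp add: All_less_Suc2)

lemma vimage_odometer_cylinder: "odometer -` cylinder (string_odometer \<sigma>) = cylinder \<sigma>"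
proof -
  let ?p = "\<lambda>i. i < length \<sigma> \<and> \<sigma> ! i"
  have p: "?p \<in> cylinder \<sigma>" "odometer ?p \<in> cylinder (string_odometer \<sigma>)"
    by (auto simp: cylinder_def odometer_def nth_string_odometer)
  show ?thesis
    using prefix_bijection_agree[OF prefix_bijection_odometer, of "length \<sigma>"]
    by (simp add: cylinder_eq_agree[OF p(1)] cylinder_eq_agree[OF p(2)] set_eq_iff)
qed

text \<open>Repeated steps lead from any string to the string of ones, so a quantity that is
  invariant under them is constant on the strings of a given length.\<close>

lemma string_odometer_transitive:
  assumes "\<And>\<sigma>. length \<sigma> = M \<Longrightarrow> f (string_odometer \<sigma>) = f \<sigma>" "length \<sigma> = M"
  shows "f \<sigma> = f (replicate M True)"
proof -
  \<comment> \<open>\<open>v\<close> is the number of steps left before the string of ones: the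
    binary value of the complemented bits, least significant first.\<close>
  define v :: "bool list \<Rightarrow> nat" where "v = rec_list 0 (\<lambda>b _ r. of_bool (\<not> b) + 2 * r)"
  have v_simps: "v [] = 0" "v (b # \<tau>) = of_bool (\<not> b) + 2 * v \<tau>" for b \<tau>
    by (simp_all add: v_def)
  have decreasing: "\<tau> = replicate (length \<tau>) True \<or> v (string_odometer \<tau>) < v \<tau>" for \<tau>
    by (induction \<tau> rule: string_odometer.induct) (auto simp: v_simps)
  show ?thesis
    using assms(2)
  proof (induction "v \<sigma>" arbitrary: \<sigma> rule: less_induct)
    case (less \<sigma>)
    show ?case
    proof (cases "\<sigma> = replicate M True")
      case False
      then have "f (string_odometer \<sigma>) = f (replicate M True)"
        using less decreasing[of \<sigma>] by (intro less(1)) auto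
      then show ?thesis
        using assms(1) less(2) by simp
    qed simp
  qed
qed

text \<open>Invariance gives C the same share of all cylinders of one length, so C is independent of
  every cylinder and hence of itself: its measure equals its own square. Invariance is assumed only
  almost everywhere because the map that T induces on the bottom floor is the odometer only off a
  null set.\<close>

lemma odometer_zero_one:
  assumes C [measurable]: "C \<in> sets borel"
    and inv: "AE y in cantor_measure. y \<in> C \<longleftrightarrow> odometer y \<in> C"
  shows "emeasure cantor_measure C = 0 \<or> emeasure cantor_measure C = 1"
proof -
  interpret prob_space cantor_measure
    by (rule prob_space_cantor_measure)
  note sets_cantor_measure [measurable_cong]
  note [measurable] = prefix_bijection_measurable[OF prefix_bijection_odometer]
  have shift: "prob (C \<inter> cylinder (string_odometer \<sigma>)) = prob (C \<inter> cylinder \<sigma>)" for \<sigma>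
  proof -
    have "emeasure cantor_measure (C \<inter> cylinder (string_odometer \<sigma>)) =
        emeasure cantor_measure (odometer -` (C \<inter> cylinder (string_odometer \<sigma>)))"
      by (rule prefix_bijection_emeasure[OF prefix_bijection_odometer, symmetric]) measurable
    also have "\<dots> = emeasure cantor_measure (odometer -` C \<inter> cylinder \<sigma>)"
      by (simp add: vimage_odometer_cylinder)
    also have "\<dots> = emeasure cantor_measure (C \<inter> cylinder \<sigma>)"
    proof (rule emeasure_eq_AE)
      show "AE y in cantor_measure. y \<in> odometer -` C \<inter> cylinder \<sigma> \<longleftrightarrow> y \<in> C \<inter> cylinder \<sigma>"
        using inv by eventually_elim auto
      have "odometer -` C \<in> sets borel"
        using measurable_sets[OF prefix_bijection_measurable[OF prefix_bijection_odometer] C] by simp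
      then show "odometer -` C \<inter> cylinder \<sigma> \<in> sets cantor_measure"
        by measurable
    qed measurable
    finally show ?thesis
      by (simp add: measure_def)
  qed
  have sets: "B \<in> events \<longleftrightarrow> B \<in> sets borel" for B
    by (simp add: sets_cantor_measure)
  have indep: "prob (C \<inter> cylinder \<sigma>) = prob C * (1/2) ^ length \<sigma>" for \<sigma>
  proof -
    let ?M = "length \<sigma>"
    have *: "prob (C \<inter> cylinder \<tau>) = prob (C \<inter> cylinder (replicate ?M True))" if "length \<tau> = ?M" for \<tau>
      using string_odometer_transitive[where f = "\<lambda>\<tau>. prob (C \<inter> cylinder \<tau>)", OF shift that] .
    have eq: "prob (C \<inter> cylinder \<tau>) = prob (C \<inter> cylinder \<sigma>)" if "length \<tau> = ?M" for \<tau>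
      by (rule trans[OF *[OF that] *[OF refl, symmetric]])
    have "emeasure cantor_measure C = (\<Sum>\<tau> | length \<tau> = ?M. emeasure cantor_measure (C \<inter> cylinder \<tau>))"
      by (rule emeasure_cylinder_split) (auto simp: sets_cantor_measure)
    then have "prob C = (\<Sum>\<tau> | length \<tau> = ?M. prob (C \<inter> cylinder \<tau>))"
      by (simp add: emeasure_eq_measure sum_nonneg)
    also have "\<dots> = (\<Sum>\<tau> :: bool list | length \<tau> = ?M. prob (C \<inter> cylinder \<sigma>))"
      by (rule sum.cong[OF refl], rule eq) simp
    also have "\<dots> = 2 ^ ?M * prob (C \<inter> cylinder \<sigma>)"
      by (simp add: card_bool_lists_length)
    finally show ?thesis
      by (simp add: power_divide)
  qed
  have "density cantor_measure (indicator C) = scale_measure (emeasure cantor_measure C) cantor_measure"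
  proof (rule measure_eqI_cylinder[where m = 0])
    show "emeasure (density cantor_measure (indicator C)) UNIV \<noteq> \<infinity>"
      by (subst emeasure_restricted) (auto simp: sets)
    show "emeasure (density cantor_measure (indicator C)) (cylinder \<sigma>) =
        emeasure (scale_measure (emeasure cantor_measure C) cantor_measure) (cylinder \<sigma>)" for \<sigma>
    proof -
      have "prob (cylinder \<sigma>) = (1/2) ^ length \<sigma>"
        by (rule measure_cylinder)
      then show ?thesis
        by (subst emeasure_restricted)
           (auto simp: sets emeasure_eq_measure indep ennreal_mult'')
    qed
  qed (simp_all add: sets_cantor_measure)
  then have "emeasure (density cantor_measure (indicator C)) C =
      emeasure (scale_measure (emeasure cantor_measure C) cantor_measure) C"
    by simp
  then have "prob C = prob C * prob C"
    by (subst (asm) emeasure_restricted) (auto simp: sets emeasure_eq_measure simp flip: ennreal_mult'')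
  then have "prob C = 0 \<or> prob C = 1"
    by simp
  then show ?thesis
    by (auto simp: emeasure_eq_measure)
qed

section \<open>Skyscrapers\<close>

lemma borel_cantor_singleton: "{y :: cantor} \<in> sets borel"
proof -
  have "{y} = (\<Inter>n. cylinder (map y [0..<n]))"
    by (auto simp: cylinder_map fun_eq_iff)
  then show ?thesis
    by (simp only:) (intro sets.countable_INT'' UNIV_I; simp)
qed

lemma emeasure_cantor_singleton: "emeasure cantor_measure {y} = 0"
proof -
  interpret prob_space cantor_measure
    by (rule prob_space_cantor_measure)
  have "prob {y} \<le> (1/2) ^ n" for n
  proof -
    have "prob {y} \<le> prob (cylinder (map y [0..<n]))"
      by (intro finite_measure_mono) (auto simp: cylinder_map sets_cantor_measure)
    then show ?thesis
      by (simp add: measure_cylinder)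
  qed
  moreover have "(\<lambda>n. (1/2 :: real) ^ n) \<longlonglongrightarrow> 0"
    by (rule LIMSEQ_power_zero) simp
  ultimately have "prob {y} \<le> 0"
    by (intro LIMSEQ_le_const[of _ 0]) auto
  then show ?thesis
    by (simp add: emeasure_eq_measure measure_le_0_iff)
qed

text \<open>\<open>h n\<close> permutes prefixes of length \<open>L n\<close> so that the n-th base
  becomes the cylinder of n ones, which fixes its measure at 2^-n. \<open>h_mono\<close> states that
  the bases decrease. Computability is expressed on codes of finite strings because \<open>L\<close>
  tells how many bits of a point matter.\<close>

locale skyscraper =
  fixes b :: bool and L :: "nat \<Rightarrow> nat" and h :: "nat \<Rightarrow> cantor \<Rightarrow> cantor"
  assumes h_0: "h 0 y = y"
    and bijection_h: "prefix_bijection (L n) (h n)"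
    and h_mono: "(\<And>i. i < Suc n \<Longrightarrow> h (Suc n) y i) \<Longrightarrow> i < n \<Longrightarrow> h n y i"
    and decidable_h_base: "decidable (\<lambda>p. h (pfst p) (code_seq (pfst (psnd p))) (psnd (psnd p)))"
    and recursive_L: "recursive_fun L"
begin

definition base :: "nat \<Rightarrow> cantor set" where
  "base n = {y. \<forall>i<n. h n y i}"

text \<open>
  The image of \<open>y\<close> on the floor of height \<open>n\<close>. It loses no information on \<^term>\<open>base n\<close>, because the
  first \<open>n\<close> entries of \<^term>\<open>h n y\<close> are then known.
\<close>

definition floor_point :: "nat \<Rightarrow> cantor \<Rightarrow> cantor" where
  "floor_point n y = (\<lambda>i. if i < n then \<not> b else if i = n then b else h n y (i - 1))"

text \<open>Beyond position n, a point of floor n lists the entries of \<open>h n y\<close> from n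
  onwards, moved by one place. The first n entries, known to be \<open>True\<close>, are put back
  before \<open>h n\<close> is inverted.\<close>

definition foot :: "nat \<Rightarrow> cantor \<Rightarrow> cantor" where
  "foot n u = inv (h n) (\<lambda>i. i < n \<or> u (Suc i))"

definition T :: "cantor \<rightharpoonup> cantor" where
  "T u = (if u = (\<lambda>_. \<not> b) then None else
     let n = (LEAST i. u i = b); y = foot n u
     in Some (if y \<in> base (Suc n) then floor_point (Suc n) y else floor_point 0 (odometer y)))"

lemma base_0: "base 0 = UNIV"
  by (simp add: base_def)

lemma base_antimono: "base (Suc n) \<subseteq> base n"
  unfolding base_def using h_mono by blast

lemma base_le: "m \<le> n \<Longrightarrow> base n \<subseteq> base m"
  using base_antimono by (rule lift_Suc_antimono_le)

text \<open>The bases decrease, so a point leaves them at most once: its tower has at most one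
  top.\<close>

lemma base_eq_of_exit:
  assumes "y \<in> base m" "y \<notin> base (Suc m)" "y \<in> base n" "y \<notin> base (Suc n)"
  shows "m = n"
  using assms base_le[of "Suc m" n] base_le[of "Suc n" m] by (cases m n rule: linorder_cases) auto

lemma bij_h: "bij (h n)"
  by (rule prefix_bijection_bij[OF bijection_h])

lemma floor_point_neq: "floor_point n y \<noteq> (\<lambda>_. \<not> b)"
proof
  assume "floor_point n y = (\<lambda>_. \<not> b)"
  then have "floor_point n y n = (\<not> b)"
    by simp
  then show False
    by (simp add: floor_point_def)
qed

lemma floor_point_Least: "(LEAST i. floor_point n y i = b) = n"
  by (rule Least_equality) (auto simp: floor_point_def not_less[symmetric])

lemma foot_floor_point:
  assumes "y \<in> base n"
  shows "foot n (floor_point n y) = y"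
proof -
  have "(\<lambda>i. i < n \<or> floor_point n y (Suc i)) = h n y"
    using assms by (intro ext) (auto simp: floor_point_def base_def)
  then show ?thesis
    using bij_h[of n] by (simp add: foot_def bij_is_inj)
qed

lemma T_floor_point:
  assumes "y \<in> base n"
  shows "T (floor_point n y) =
    Some (if y \<in> base (Suc n) then floor_point (Suc n) y else floor_point 0 (odometer y))"
  by (simp add: T_def floor_point_neq floor_point_Least foot_floor_point[OF assms])

text \<open>Floor and foot serve as coordinates for all points except the constant one: the floor is
  the position of the first b, and surjectivity of \<open>h n\<close> provides the foot.\<close>

lemma floor_point_cases:
  assumes "u \<noteq> (\<lambda>_. \<not> b)"
  obtains n y where "y \<in> base n" "u = floor_point n y"
proof -
  define n where "n = (LEAST i. u i = b)"
  define y where "y = foot n u"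
  have "\<exists>i. u i = b"
    using assms by auto
  then have n: "u n = b"
    unfolding n_def by (rule LeastI_ex)
  have less_n: "u i = (\<not> b)" if "i < n" for i
    using not_less_Least[of i "\<lambda>i. u i = b"] that unfolding n_def by auto
  have h_y: "h n y = (\<lambda>i. i < n \<or> u (Suc i))"
    using bij_h[of n] by (simp add: y_def foot_def bij_is_surj surj_f_inv_f)
  have "u i = floor_point n y i" for i
    using n less_n by (cases i) (auto simp: floor_point_def h_y)
  then show ?thesis
    by (intro that[of y n]) (auto simp: base_def h_y)
qed

lemma floor_point_eq_iff:
  assumes "y \<in> base n" "z \<in> base m"
  shows "floor_point n y = floor_point m z \<longleftrightarrow> n = m \<and> y = z"
proof
  assume eq: "floor_point n y = floor_point m z"
  then have "n = m"
    using floor_point_Least by metis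
  then show "n = m \<and> y = z"
    using eq assms foot_floor_point by metis
qed simp

lemma dom_T: "dom T = - {\<lambda>_. \<not> b}"
  by (auto simp: T_def dom_def Let_def split: if_splits)

lemma ran_T: "ran T \<subseteq> dom T"
proof
  fix v assume "v \<in> ran T"
  then obtain u where u: "T u = Some v"
    by (auto simp: ran_def)
  then have "u \<noteq> (\<lambda>_. \<not> b)"
    by (auto simp: T_def)
  then obtain n y where "y \<in> base n" "u = floor_point n y"
    by (rule floor_point_cases)
  then show "v \<in> dom T"
    using u floor_point_neq by (auto simp: T_floor_point dom_T split: if_splits)
qed

text \<open>Points above the bottom are reached only from the floor below. Points of the bottom are
  reached only from tops of towers, where the odometer determines the foot and the foot determines
  the height.\<close>

lemma inj_on_T: "inj_on T (dom T)"
proof (rule inj_onI)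
  fix u v assume uv: "u \<in> dom T" "v \<in> dom T" "T u = T v"
  have "u \<noteq> (\<lambda>_. \<not> b)" "v \<noteq> (\<lambda>_. \<not> b)"
    using uv by (auto simp: dom_T)
  then obtain n y m z where u: "y \<in> base n" "u = floor_point n y"
    and v: "z \<in> base m" "v = floor_point m z"
    by (metis floor_point_cases)
  have "odometer y = odometer z \<longleftrightarrow> y = z"
    using prefix_bijection_bij[OF prefix_bijection_odometer] by (simp add: bij_is_inj inj_eq)
  moreover have "odometer w \<in> base 0" for w
    by (simp add: base_0)
  ultimately show "u = v"
    using uv(3) u v
    by (auto simp: T_floor_point floor_point_eq_iff split: if_splits dest: base_eq_of_exit)
qed

section \<open>Measurability and measure of the floors\<close>

lemma measurable_h [measurable]: "h n \<in> borel \<rightarrow>\<^sub>M borel"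
  by (rule prefix_bijection_measurable[OF bijection_h])

lemma measurable_odometer [measurable]: "odometer \<in> borel \<rightarrow>\<^sub>M borel"
  by (rule prefix_bijection_measurable[OF prefix_bijection_odometer])

lemma measurable_floor_point [measurable]: "floor_point n \<in> borel \<rightarrow>\<^sub>M borel"
proof -
  have "(\<lambda>z :: cantor. z (i - 1)) \<in> borel \<rightarrow>\<^sub>M borel" for i
    by (rule measurable_product_coordinates)
  from measurable_compose[OF measurable_h this]
  have coordinate: "(\<lambda>y. h n y (i - 1)) \<in> borel \<rightarrow>\<^sub>M borel" for i .
  show ?thesis
  proof (rule measurable_coordinatewise_then_product)
    fix i
    show "(\<lambda>y. floor_point n y i) \<in> borel \<rightarrow>\<^sub>M borel"
      unfolding floor_point_def using coordinate[of i] by (cases "i < n"; cases "i = n"; simp only: if_True if_False measurable_const) simp_all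
  qed
qed

lemma measurable_foot [measurable]: "foot n \<in> borel \<rightarrow>\<^sub>M borel"
proof -
  have "(\<lambda>z :: cantor. i < n \<or> z (Suc i)) \<in> borel \<rightarrow>\<^sub>M borel" for i
    by (cases "i < n") (simp_all add: measurable_product_coordinates)
  then have "(\<lambda>z :: cantor. \<lambda>i. i < n \<or> z (Suc i)) \<in> borel \<rightarrow>\<^sub>M borel"
    by (rule measurable_coordinatewise_then_product)
  from measurable_compose[OF this prefix_bijection_measurable[OF prefix_bijection_inv[OF bijection_h]]]
  show ?thesis
    unfolding foot_def .
qed

lemma base_eq_vimage: "base n = h n -` cylinder (replicate n True)"
  by (intro set_eqI) (simp add: base_def cylinder_def)

lemma borel_base [measurable]: "base n \<in> sets borel"
  using measurable_sets[OF measurable_h cylinder_borel] by (simp add: base_eq_vimage)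

lemma emeasure_base: "emeasure cantor_measure (base n) = (1/2) ^ n"
  unfolding base_eq_vimage
  by (subst prefix_bijection_emeasure[OF bijection_h]) (simp_all add: emeasure_cylinder)

definition floor_cylinder :: "nat \<Rightarrow> cantor set" where
  "floor_cylinder n = cylinder (replicate n (\<not> b) @ [b])"

lemma floor_cylinder_iff: "u \<in> floor_cylinder n \<longleftrightarrow> (\<forall>i<n. u i = (\<not> b)) \<and> u n = b"
  by (subst conj_commute) (simp add: floor_cylinder_def cylinder_def nth_append All_less_Suc)

lemma floor_point_mem: "floor_point n y \<in> floor_cylinder n"
  by (simp add: floor_cylinder_iff floor_point_def)

text \<open>\<open>h n\<close> preserves measure and turns feet into n ones followed by a tail. On
  the floor the same tail follows a prefix of length n + 1, and this extra entry costs the factor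
  1/2.\<close>

lemma emeasure_floor:
  assumes B: "B \<in> sets borel"
  shows "emeasure cantor_measure (B \<inter> floor_cylinder n) =
    1/2 * emeasure cantor_measure (base n \<inter> floor_point n -` B)"
proof -
  define g :: "cantor \<Rightarrow> cantor" where
    "g w = (\<lambda>i. if i < n then \<not> b else if i = n then b else w (i - Suc n))" for w
  have "(\<lambda>w. g w i) \<in> borel \<rightarrow>\<^sub>M borel" for i
    by (simp add: g_def measurable_product_coordinates)
  then have "g \<in> borel \<rightarrow>\<^sub>M borel"
    by (rule measurable_coordinatewise_then_product)
  from measurable_sets[OF this B] have C: "g -` B \<in> sets borel"
    by simp
  have "g (\<lambda>i. h n y (i + n)) = floor_point n y" if "y \<in> base n" for y
    by (intro ext) (auto simp: g_def floor_point_def)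
  then have "base n \<inter> floor_point n -` B =
      h n -` {z \<in> cylinder (replicate n True). (\<lambda>i. z (i + length (replicate n True))) \<in> g -` B}"
    by (auto simp: base_eq_vimage)
  also have "emeasure cantor_measure \<dots> =
      emeasure cantor_measure {z \<in> cylinder (replicate n True). (\<lambda>i. z (i + length (replicate n True))) \<in> g -` B}"
  proof (rule prefix_bijection_emeasure[OF bijection_h])
    have "(\<lambda>z :: cantor. \<lambda>i. z (i + length (replicate n True))) -` (g -` B) \<in> sets borel"
      using measurable_sets[OF measurable_cantor_shift C] by simp
    then have "cylinder (replicate n True) \<inter> (\<lambda>z :: cantor. \<lambda>i. z (i + length (replicate n True))) -` (g -` B) \<in> sets borel"
      by measurable
    then show "{z \<in> cylinder (replicate n True). (\<lambda>i. z (i + length (replicate n True))) \<in> g -` B} \<in> sets borel"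
      by (simp add: vimage_def Int_def)
  qed
  also have "\<dots> = (1/2) ^ n * emeasure cantor_measure (g -` B)"
    using emeasure_cylinder_shift[OF C, of "replicate n True"] by simp
  finally have base: "1/2 * emeasure cantor_measure (base n \<inter> floor_point n -` B) =
      (1/2) ^ Suc n * emeasure cantor_measure (g -` B)"
    by (simp add: mult.assoc)
  have "g (\<lambda>i. u (i + Suc n)) = u" if "u \<in> floor_cylinder n" for u
    using that by (intro ext) (auto simp: g_def floor_cylinder_iff not_less Suc_le_eq[symmetric])
  then have "B \<inter> floor_cylinder n =
      {z \<in> cylinder (replicate n (\<not> b) @ [b]). (\<lambda>i. z (i + length (replicate n (\<not> b) @ [b]))) \<in> g -` B}"
    by (auto simp: floor_cylinder_def)
  then have "emeasure cantor_measure (B \<inter> floor_cylinder n) = (1/2) ^ Suc n * emeasure cantor_measure (g -` B)"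
    by (simp only: emeasure_cylinder_shift[OF C]) simp
  then show ?thesis
    by (simp only: base)
qed

text \<open>The floors are disjoint and miss only the constant sequence, which is null, so sets can
  be measured through their feet.\<close>

lemma emeasure_eq_suminf_floors:
  assumes B: "B \<in> sets borel"
  shows "emeasure cantor_measure B = 1/2 * (\<Sum>n. emeasure cantor_measure (base n \<inter> floor_point n -` B))"
proof -
  have [measurable]: "floor_cylinder n \<in> sets borel" for n
    by (simp add: floor_cylinder_def)
  have "disjoint_family (\<lambda>n. B \<inter> floor_cylinder n)"
    unfolding disjoint_family_on_def
  proof (intro ballI impI)
    show "B \<inter> floor_cylinder m \<inter> (B \<inter> floor_cylinder n) = {}" if "m \<noteq> n" for m n
      using that by (cases m n rule: linorder_cases) (auto simp: floor_cylinder_iff)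
  qed
  then have "(\<Sum>n. emeasure cantor_measure (B \<inter> floor_cylinder n)) =
      emeasure cantor_measure (\<Union>n. B \<inter> floor_cylinder n)"
    using B by (intro suminf_emeasure) (auto simp: sets_cantor_measure)
  also have "(\<Union>n. B \<inter> floor_cylinder n) = B - {\<lambda>_. \<not> b}"
  proof -
    have "(\<Union>n. floor_cylinder n) = - {\<lambda>_ :: nat. \<not> b}"
    proof (intro equalityI subsetI)
      fix u :: cantor assume "u \<in> - {\<lambda>_. \<not> b}"
      then have "u \<noteq> (\<lambda>_. \<not> b)"
        by simp
      then obtain n y where "u = floor_point n y"
        by (rule floor_point_cases)
      then show "u \<in> (\<Union>n. floor_cylinder n)"
        using floor_point_mem by blast
    qed (auto simp: floor_cylinder_iff)
    then show ?thesis
      by (simp add: Int_UN_distrib[symmetric] Diff_eq)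
  qed
  also have "emeasure cantor_measure (B - {\<lambda>_. \<not> b}) = emeasure cantor_measure B"
    using B by (intro emeasure_Diff_null_set)
      (auto simp: null_sets_def emeasure_cantor_singleton sets_cantor_measure borel_cantor_singleton)
  finally show ?thesis
    using B by (simp add: emeasure_floor)
qed

text \<open>The feet of infinite towers lie in every base, hence in sets of measure 2^-n for every
  n.\<close>

lemma AE_not_base: "AE y in cantor_measure. \<exists>n. y \<notin> base n"
proof -
  interpret prob_space cantor_measure
    by (rule prob_space_cantor_measure)
  have sets: "base n \<in> events" for n
    by (simp add: sets_cantor_measure)
  have "prob (\<Inter>n. base n) \<le> (1/2) ^ n" for n
  proof -
    have "prob (\<Inter>n. base n) \<le> prob (base n)"
      by (intro finite_measure_mono sets) auto
    also have "prob (base n) = (1/2) ^ n"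
      using emeasure_base[of n] emeasure_cylinder[of "replicate n True"] measure_cylinder[of "replicate n True"]
      by (simp add: measure_def)
    finally show ?thesis .
  qed
  moreover have "(\<lambda>n. (1/2 :: real) ^ n) \<longlonglongrightarrow> 0"
    by (rule LIMSEQ_power_zero) simp
  ultimately have "prob (\<Inter>n. base n) \<le> 0"
    by (intro LIMSEQ_le_const[of _ 0]) auto
  then have "(\<Inter>n. base n) \<in> null_sets cantor_measure"
    by (intro null_setsI) (auto simp: emeasure_eq_measure measure_le_0_iff intro: sets)
  from AE_not_in[OF this] show ?thesis
    by simp
qed

section \<open>Measure preservation and ergodicity\<close>

lemma borel_partial_vimage:
  assumes B: "B \<in> sets borel"
  shows "partial_vimage T B \<in> sets borel"
proof -
  have [measurable]: "floor_cylinder n \<in> sets borel" for n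
    by (simp add: floor_cylinder_def)
  \<comment> \<open>The part of the preimage on floor n, split by whether its foot continues upwards
    or returns. The foot map is total and measurable, which avoids measurability of a partial
    map.\<close>
  let ?X = "\<lambda>n. floor_cylinder n \<inter> foot n -` (base n \<inter>
      (base (Suc n) \<inter> floor_point (Suc n) -` B \<union>
       (- base (Suc n)) \<inter> odometer -` (floor_point 0 -` B)))"
  have "?X n \<in> sets borel" for n
  proof -
    note V = measurable_sets[where A = borel and M = borel, simplified]
    have "odometer -` (floor_point 0 -` B) \<in> sets borel" "floor_point (Suc n) -` B \<in> sets borel"
      by (intro V[OF measurable_odometer] V[OF measurable_floor_point] B)+
    then have "base n \<inter> (base (Suc n) \<inter> floor_point (Suc n) -` B \<union>
       (- base (Suc n)) \<inter> odometer -` (floor_point 0 -` B)) \<in> sets borel"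
      by (intro sets.Int sets.Un borel_comp borel_base)
    from V[OF measurable_foot this] show ?thesis
      by measurable
  qed
  moreover have "partial_vimage T B = (\<Union>n. ?X n)"
  proof (intro equalityI subsetI)
    fix u assume "u \<in> partial_vimage T B"
    then obtain v where v: "v \<in> B" "T u = Some v"
      by (auto simp: partial_vimage_def)
    then have "u \<noteq> (\<lambda>_. \<not> b)"
      by (auto simp: T_def)
    then obtain n y where "y \<in> base n" "u = floor_point n y"
      by (rule floor_point_cases)
    then have "u \<in> ?X n"
      using v by (auto simp: foot_floor_point T_floor_point floor_point_mem split: if_splits)
    then show "u \<in> (\<Union>n. ?X n)"
      by blast
  next
    fix u assume "u \<in> (\<Union>n. ?X n)"
    then obtain n where u: "u \<in> ?X n"
      by blast
    then have "u \<noteq> (\<lambda>_. \<not> b)"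
      by (auto simp: floor_cylinder_iff)
    then obtain m y where y: "y \<in> base m" "u = floor_point m y"
      by (rule floor_point_cases)
    have "(LEAST i. u i = b) = n"
      by (rule Least_equality) (use u in \<open>auto simp: floor_cylinder_iff not_less[symmetric]\<close>)
    with y(2) have "m = n"
      by (simp add: floor_point_Least)
    with u y show "u \<in> partial_vimage T B"
      by (auto simp: partial_vimage_def T_floor_point foot_floor_point)
  qed
  ultimately show ?thesis
    by simp
qed

lemma floor_point_in_partial_vimage:
  assumes "y \<in> base n"
  shows "floor_point n y \<in> partial_vimage T B \<longleftrightarrow>
    (if y \<in> base (Suc n) then floor_point (Suc n) y \<in> B else floor_point 0 (odometer y) \<in> B)"
  by (simp add: partial_vimage_def T_floor_point[OF assms] image_iff)

text \<open>This description of a step in terms of feet is what both measure preservation and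
  ergodicity rest on.\<close>

lemma base_Int_vimage_partial_vimage:
  "base n \<inter> floor_point n -` partial_vimage T B =
     base (Suc n) \<inter> floor_point (Suc n) -` B \<union> (base n - base (Suc n)) \<inter> odometer -` (floor_point 0 -` B)"
proof (intro set_eqI)
  fix y
  show "y \<in> base n \<inter> floor_point n -` partial_vimage T B \<longleftrightarrow>
    y \<in> base (Suc n) \<inter> floor_point (Suc n) -` B \<union> (base n - base (Suc n)) \<inter> odometer -` (floor_point 0 -` B)"
    using base_antimono[of n] by (cases "y \<in> base n") (auto simp: floor_point_in_partial_vimage)
qed

text \<open>Up to the factor 1/2, \<open>I n\<close> is the measure of B on floor n. Taking
  preimages moves the share of floor n + 1 down to floor n, while the share of the bottom is spread
  over the tops of towers as the \<open>J n\<close>. So the total is unchanged.\<close>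

lemma measure_preserving_T: "measure_preserving_transformation T"
  unfolding measure_preserving_transformation_def
proof (intro conjI ballI ran_T borel_partial_vimage)
  fix B :: "cantor set" assume B: "B \<in> sets borel"
  define D where "D = odometer -` (floor_point 0 -` B)"
  define I where "I n = emeasure cantor_measure (base n \<inter> floor_point n -` B)" for n
  define J where "J n = emeasure cantor_measure ((base n - base (Suc n)) \<inter> D)" for n
  note V = measurable_sets[where A = borel and M = borel, simplified]
  have fp: "floor_point n -` B \<in> sets borel" for n
    by (intro V[OF measurable_floor_point] B)
  have D: "D \<in> sets borel"
    unfolding D_def by (intro V[OF measurable_odometer] fp)
  have split: "emeasure cantor_measure (base n \<inter> floor_point n -` partial_vimage T B) = I (Suc n) + J n" for n
    unfolding base_Int_vimage_partial_vimage I_def J_def D_def[symmetric]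
    by (rule plus_emeasure[symmetric])
       (use fp D in \<open>auto simp: sets_cantor_measure intro!: sets.Int\<close>)
  \<comment> \<open>Almost every tower is finite, so the sets of feet leaving at each height
    partition the space up to a null set. The odometer then gives the bottom share.\<close>
  have "(\<Sum>n. J n) = emeasure cantor_measure (\<Union>n. (base n - base (Suc n)) \<inter> D)"
    unfolding J_def
  proof (rule suminf_emeasure)
    show "range (\<lambda>n. (base n - base (Suc n)) \<inter> D) \<subseteq> sets cantor_measure"
      using D by (auto simp: sets_cantor_measure intro!: sets.Int)
    show "disjoint_family (\<lambda>n. (base n - base (Suc n)) \<inter> D)"
      unfolding disjoint_family_on_def by (auto dest: base_eq_of_exit)
  qed
  also have "\<dots> = emeasure cantor_measure D"
  proof (rule emeasure_eq_AE)
    show "AE y in cantor_measure. y \<in> (\<Union>n. (base n - base (Suc n)) \<inter> D) \<longleftrightarrow> y \<in> D"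
      using AE_not_base
    proof eventually_elim
      fix y assume *: "\<exists>n. y \<notin> base n"
      define k where "k = (LEAST n. y \<notin> base n)"
      have "y \<notin> base k"
        unfolding k_def using * by (rule LeastI_ex)
      moreover then obtain n where n: "k = Suc n"
        using base_0 by (cases k) auto
      moreover have "y \<in> base n"
        using not_less_Least[of n "\<lambda>n. y \<notin> base n"] n unfolding k_def by auto
      ultimately show "y \<in> (\<Union>n. (base n - base (Suc n)) \<inter> D) \<longleftrightarrow> y \<in> D"
        by blast
    qed
  qed (use D in \<open>auto simp: sets_cantor_measure\<close>)
  also have "\<dots> = I 0"
    unfolding D_def I_def base_0 using prefix_bijection_emeasure[OF prefix_bijection_odometer fp] by simp
  finally have J: "(\<Sum>n. J n) = I 0" .
  have "emeasure cantor_measure (partial_vimage T B) = 1/2 * (\<Sum>n. I (Suc n) + J n)"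
    using emeasure_eq_suminf_floors[OF borel_partial_vimage[OF B]] by (simp add: split)
  also have "(\<Sum>n. I (Suc n) + J n) = (\<Sum>n. I (Suc n)) + (\<Sum>n. J n)"
    by (rule suminf_add[symmetric]) (simp_all add: summableI)
  also have "\<dots> = (\<Sum>n. I n)"
    unfolding J using suminf_offset[of I 1] by (simp add: summableI add.commute)
  also have "1/2 * \<dots> = emeasure cantor_measure B"
    unfolding I_def by (rule emeasure_eq_suminf_floors[OF B, symmetric])
  finally show "emeasure cantor_measure (partial_vimage T B) = emeasure cantor_measure B" .
qed

text \<open>An invariant set contains all or nothing of each tower, so it is determined by its trace
  C on the bottom. Returning from the top of a finite tower applies the odometer, so C is invariant
  almost everywhere and has measure 0 or 1.\<close>

lemma ergodic_T: "ergodic_transformation T"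
  unfolding ergodic_transformation_def
proof (intro ballI impI)
  fix B :: "cantor set" assume B: "B \<in> sets borel" and inv: "partial_vimage T B = B"
  define C where "C = floor_point 0 -` B"
  have C: "C \<in> sets borel"
    unfolding C_def using measurable_sets[OF measurable_floor_point B] by simp
  have step: "base n \<inter> floor_point n -` B =
     base (Suc n) \<inter> floor_point (Suc n) -` B \<union> (base n - base (Suc n)) \<inter> odometer -` C" for n
    using base_Int_vimage_partial_vimage[of n B] by (simp add: inv C_def)
  have fp: "base n \<inter> floor_point n -` B = base n \<inter> C" for n
  proof (induction n)
    case (Suc n)
    have "y \<in> base (Suc n) \<inter> floor_point (Suc n) -` B \<longleftrightarrow> y \<in> base (Suc n) \<inter> C" for y
      using eqset_imp_iff[OF step[of n], of y] eqset_imp_iff[OF Suc, of y] base_antimono[of n]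
      by auto
    then show ?case
      by blast
  qed (simp add: C_def)
  have "y \<in> C \<longleftrightarrow> odometer y \<in> C" if "y \<in> base n - base (Suc n)" for n y
    using step[of n] fp[of n] that by blast
  \<comment> \<open>If y is missing from \<open>base k\<close>, its tower has a top below k, and the
    previous fact applies there.\<close>
  then have eq: "y \<in> C \<longleftrightarrow> odometer y \<in> C" if "y \<notin> base k" for y k
    using that by (induction k) (use base_0 in auto)
  have "AE y in cantor_measure. y \<in> C \<longleftrightarrow> odometer y \<in> C"
    using AE_not_base by eventually_elim (use eq in blast)
  then consider "emeasure cantor_measure C = 0" | "emeasure cantor_measure C = 1"
    using odometer_zero_one[OF C] by blast
  then show "emeasure cantor_measure B = 0 \<or> emeasure cantor_measure B = 1"
  proof cases
    case 1
    have "emeasure cantor_measure (base n \<inter> C) = 0" for n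
      by (rule emeasure_eq_0[OF _ 1]) (use C in \<open>auto simp: sets_cantor_measure\<close>)
    then show ?thesis
      using emeasure_eq_suminf_floors[OF B] by (simp add: fp)
  next
    case 2
    interpret prob_space cantor_measure
      by (rule prob_space_cantor_measure)
    have "AE y in cantor_measure. y \<in> C"
      by (rule AE_prob_1) (use 2 in \<open>simp add: measure_def\<close>)
    then have "emeasure cantor_measure (base n \<inter> C) = emeasure cantor_measure (base n \<inter> UNIV)" for n
      by (intro emeasure_eq_AE) (use C in \<open>auto simp: sets_cantor_measure\<close>)
    moreover have "floor_point n -` UNIV = UNIV" for n
      by simp
    ultimately have "emeasure cantor_measure B = emeasure cantor_measure UNIV"
      using emeasure_eq_suminf_floors[OF B] emeasure_eq_suminf_floors[of UNIV] by (simp add: fp)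
    then show ?thesis
      by (simp add: emeasure_cantor_measure_UNIV)
  qed
qed

section \<open>Computability of the transformation\<close>

definition next_point :: "nat \<Rightarrow> cantor \<Rightarrow> cantor" where
  "next_point n y = (if y \<in> base (Suc n) then floor_point (Suc n) y else floor_point 0 (odometer y))"

text \<open>The bound \<open>i \<le> M\<close> is not strict: entry n of a floor point is inserted
  for free, so M bits of the foot determine M + 1 bits of the point.\<close>

lemma floor_point_agree:
  assumes "\<forall>i<M. y i = z i" "L n \<le> M" "i \<le> M"
  shows "floor_point n y i = floor_point n z i"
  using prefix_bijection_agree[OF bijection_h assms(2), of y z] assms(1,3)
  by (auto simp: floor_point_def)

lemma base_agree:
  assumes "\<forall>i<M. y i = z i" "L n \<le> M" "n \<le> M"
  shows "y \<in> base n \<longleftrightarrow> z \<in> base n"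
  using prefix_bijection_agree[OF bijection_h assms(2), of y z] assms(1,3)
  by (auto simp: base_def)

lemma next_point_agree:
  assumes "\<forall>i<M. y i = z i" "L (Suc n) \<le> M" "Suc n \<le> M" "i \<le> M"
  shows "next_point n y i = next_point n z i"
proof -
  have "\<forall>i<M. odometer y i = odometer z i"
    using prefix_bijection_agree[OF prefix_bijection_odometer, of M y z] assms(1) by simp
  then have "floor_point 0 (odometer y) i = floor_point 0 (odometer z) i"
    using assms(4) by (auto simp: floor_point_def h_0)
  then show ?thesis
    using base_agree[OF assms(1-3)] floor_point_agree[OF assms(1,2,4)] by (simp add: next_point_def)
qed

lemma decidable_h:
  "recursive_fun f \<Longrightarrow> recursive_fun g \<Longrightarrow> recursive_fun k \<Longrightarrow>
    decidable (\<lambda>e. h (f e) (code_seq (g e)) (k e))"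
  by (rule decidable_comp3[OF decidable_h_base])

lemma decidable_floor_point:
  "recursive_fun f \<Longrightarrow> recursive_fun g \<Longrightarrow> recursive_fun k \<Longrightarrow>
    decidable (\<lambda>e. floor_point (f e) (code_seq (g e)) (k e))"
  unfolding floor_point_def by (intro recursive_intros decidable_h)

lemma decidable_next_point:
  "recursive_fun f \<Longrightarrow> recursive_fun g \<Longrightarrow> recursive_fun k \<Longrightarrow>
    decidable (\<lambda>e. next_point (f e) (code_seq (g e)) (k e))"
proof (rule decidable_comp3)
  have "next_point n y i \<longleftrightarrow>
      (if \<forall>j<Suc n. h (Suc n) y j then floor_point (Suc n) y i
       else if i = 0 then b else \<not> (y (i - 1) \<longleftrightarrow> (\<forall>j<i - 1. y j)))" for n y i
    by (auto simp: next_point_def base_def floor_point_def h_0 odometer_def)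
  then show "decidable (\<lambda>p. next_point (pfst p) (code_seq (pfst (psnd p))) (psnd (psnd p)))"
    by (simp only:) (intro recursive_intros decidable_h decidable_floor_point decidable_code_seq)
qed

text \<open>The witness c guesses a floor and a finite approximation of the foot, and
  \<open>D\<close> verifies the guess by moving upwards from the foot. Thus no inverse of
  \<open>h n\<close> has to be computed.\<close>

lemma computable_T: "computable_transformation T"
proof -
  \<comment> \<open>The bounds on \<open>L\<close> and the height are strict because M + 1 bits of a
    point on a known floor determine only M bits of its foot.\<close>
  define D where "D s t c \<longleftrightarrow>
      L (pfst c) < code_length t \<and> L (Suc (pfst c)) < code_length t \<and> Suc (pfst c) < code_length t \<and>
      code_length s \<le> code_length t \<and> (\<forall>i<pfst c. h (pfst c) (code_seq (psnd c)) i) \<and>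
      (\<forall>i<code_length t. code_seq t i \<longleftrightarrow> floor_point (pfst c) (code_seq (psnd c)) i) \<and>
      (\<forall>i<code_length s. code_seq s i \<longleftrightarrow> next_point (pfst c) (code_seq (psnd c)) i)" for s t c
  define W where "W = {(\<sigma>, \<tau>). \<exists>c. D (string_code \<sigma>) (string_code \<tau>) c}"
  have "ce_string_pairs W"
  proof (rule ce_string_pairsI)
    show "decidable (\<lambda>p. D (pfst p) (pfst (psnd p)) (psnd (psnd p)))"
      unfolding D_def
      by (intro recursive_intros decidable_h decidable_floor_point decidable_next_point
          decidable_code_seq recursive_fun.comp[OF recursive_L])
  qed (simp add: W_def)
  moreover have "partial_vimage T (cylinder \<sigma>) = dom T \<inter> (\<Union>\<tau>\<in>{\<tau>. (\<sigma>, \<tau>) \<in> W}. cylinder \<tau>)" for \<sigma>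
  proof (intro equalityI subsetI)
    fix u assume "u \<in> partial_vimage T (cylinder \<sigma>)"
    then obtain v where v: "T u = Some v" "v \<in> cylinder \<sigma>"
      by (auto simp: partial_vimage_def)
    then have "u \<noteq> (\<lambda>_. \<not> b)"
      by (auto simp: T_def)
    then obtain n y where y: "y \<in> base n" "u = floor_point n y"
      by (rule floor_point_cases)
    then have v_eq: "v = next_point n y"
      using v(1) by (simp add: T_floor_point next_point_def)
    \<comment> \<open>A common bound for the two moduli, the next height and the number of image
      bits wanted.\<close>
    define M where "M = L n + L (Suc n) + Suc n + length \<sigma>"
    define c where "c = prod_encode (n, string_code (map y [0..<M]))"
    have n: "pfst c = n"
      by (simp add: c_def)
    have agree: "\<forall>i<M. code_seq (psnd c) i = y i"
      by (simp add: c_def code_seq_string_code)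
    have "D (string_code \<sigma>) (string_code (map u [0..<Suc M])) c"
      unfolding D_def n
    proof (intro conjI allI impI)
      show "h n (code_seq (psnd c)) i" if "i < n" for i
        using base_agree[OF agree, of n] y(1) that by (simp add: M_def base_def)
      show "code_seq (string_code (map u [0..<Suc M])) i \<longleftrightarrow> floor_point n (code_seq (psnd c)) i"
        if "i < code_length (string_code (map u [0..<Suc M]))" for i
        using that floor_point_agree[OF agree, of n i]
        by (simp add: code_seq_string_code M_def y(2) del: upt_Suc)
      show "code_seq (string_code \<sigma>) i \<longleftrightarrow> next_point n (code_seq (psnd c)) i"
        if "i < code_length (string_code \<sigma>)" for i
        using that next_point_agree[OF agree, of n i] v(2)
        by (simp add: code_seq_string_code M_def v_eq cylinder_def)
    qed (simp_all add: M_def)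
    then have "(\<sigma>, map u [0..<Suc M]) \<in> W"
      by (auto simp: W_def)
    moreover have "u \<in> cylinder (map u [0..<Suc M])"
      by (simp add: cylinder_map del: upt_Suc)
    ultimately show "u \<in> dom T \<inter> (\<Union>\<tau>\<in>{\<tau>. (\<sigma>, \<tau>) \<in> W}. cylinder \<tau>)"
      using v(1) by blast
  next
    fix u assume u: "u \<in> dom T \<inter> (\<Union>\<tau>\<in>{\<tau>. (\<sigma>, \<tau>) \<in> W}. cylinder \<tau>)"
    then obtain \<tau> c where D: "D (string_code \<sigma>) (string_code \<tau>) c" and u_\<tau>: "u \<in> cylinder \<tau>"
      by (auto simp: W_def)
    define n where "n = pfst c"
    define z where "z = code_seq (psnd c)"
    define M where "M = length \<tau> - 1"
    have "L (pfst c) < length \<tau>"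
      using D by (simp add: D_def)
    then have length_\<tau>: "length \<tau> = Suc M"
      by (simp add: M_def)
    have M: "L n \<le> M" "L (Suc n) \<le> M" "Suc n \<le> M" "length \<sigma> \<le> Suc M"
      using D by (simp_all add: D_def n_def length_\<tau>)
    have z: "z \<in> base n"
      using D by (simp add: D_def base_def n_def z_def)
    have u_eq: "u i = floor_point n z i" if "i \<le> M" for i
      using D u_\<tau> that by (simp add: D_def n_def z_def length_\<tau> cylinder_def code_seq_string_code)
    have \<sigma>_eq: "\<sigma> ! i = next_point n z i" if "i < length \<sigma>" for i
      using D that by (simp add: D_def n_def z_def code_seq_string_code)
    have "u \<noteq> (\<lambda>_. \<not> b)"
      using u by (auto simp: dom_T)
    then obtain m y where y: "y \<in> base m" "u = floor_point m y"
      by (rule floor_point_cases)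
    have "u \<in> floor_cylinder n"
      using floor_point_mem[of n z] M(3) u_eq by (simp add: floor_cylinder_iff)
    then have "(LEAST i. u i = b) = n"
      by (intro Least_equality) (auto simp: floor_cylinder_iff not_less[symmetric])
    then have m: "m = n"
      using y(2) by (simp add: floor_point_Least)
    have "h n y i = h n z i" if "i < M" for i
    proof (cases "i < n")
      case True
      then show ?thesis
        using y(1) z by (simp add: base_def m)
    next
      case False
      then show ?thesis
        using u_eq[of "Suc i"] that by (simp add: y(2) m floor_point_def)
    qed
    then have agree: "\<forall>i<M. y i = z i"
      using prefix_bijection_agree[OF bijection_h M(1), of y z] by simp
    have "next_point n y \<in> cylinder \<sigma>"
      using next_point_agree[OF agree M(2,3)] M(4) \<sigma>_eq by (simp add: cylinder_def)
    then show "u \<in> partial_vimage T (cylinder \<sigma>)"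
      using y by (simp add: partial_vimage_def T_floor_point next_point_def m)
  qed
  ultimately show ?thesis
    unfolding computable_transformation_def by blast
qed

lemma Sigma01_dom_T: "Sigma01 (dom T)"
proof -
  define W where "W = {\<tau>. \<exists>i<length \<tau>. \<tau> ! i = b}"
  have "ce_strings W"
  proof (rule ce_stringsI)
    show "decidable (\<lambda>p. \<exists>i<code_length (pfst p). code_seq (pfst p) i \<longleftrightarrow> b)"
      by (intro recursive_intros decidable_code_seq)
    show "\<tau> \<in> W \<longleftrightarrow> (\<exists>c. \<exists>i<code_length (string_code \<tau>). code_seq (string_code \<tau>) i = b)" for \<tau>
      by (auto simp: W_def code_seq_string_code)
  qed
  moreover have "dom T = (\<Union>\<tau>\<in>W. cylinder \<tau>)"
  proof (intro equalityI subsetI)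
    fix u assume "u \<in> dom T"
    then obtain i where "u i = b"
      by (auto simp: dom_T)
    then have "map u [0..<Suc i] \<in> W"
      by (auto simp: W_def simp del: upt_Suc intro!: exI[of _ i])
    moreover have "u \<in> cylinder (map u [0..<Suc i])"
      by (simp add: cylinder_map del: upt_Suc)
    ultimately show "u \<in> (\<Union>\<tau>\<in>W. cylinder \<tau>)"
      by blast
  next
    fix u assume "u \<in> (\<Union>\<tau>\<in>W. cylinder \<tau>)"
    then obtain \<tau> i where "i < length \<tau>" "\<tau> ! i = b" "u \<in> cylinder \<tau>"
      by (auto simp: W_def)
    then have "u i = b"
      by (simp add: cylinder_def)
    then show "u \<in> dom T"
      by (auto simp: dom_T)
  qed
  ultimately show ?thesis
    unfolding Sigma01_def by blast
qed

lemma partial_iterate_floor_point: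
  assumes "\<And>n. y \<in> base n"
  shows "partial_iterate T k (floor_point 0 y) = Some (floor_point k y)"
  by (induction k) (simp_all add: T_floor_point assms)

end

section \<open>Ranking strings by the time at which they are covered\<close>

fun prefix_num :: "cantor \<Rightarrow> nat \<Rightarrow> nat" where
  "prefix_num y 0 = 0"
| "prefix_num y (Suc l) = 2 * prefix_num y l + of_bool (y l)"

lemma prefix_num_less: "prefix_num y l < 2 ^ l"
  by (induction l) auto

text \<open>Numbers are read with the most significant bit first, unlike in the odometer, so
  shortening a string is division by a power of 2.\<close>

lemma prefix_num_div: "l \<le> m \<Longrightarrow> prefix_num y m div 2 ^ (m - l) = prefix_num y l"
proof (induction m)
  case (Suc m)
  show ?case
  proof (cases "l = Suc m")
    case False
    then have l: "l \<le> m"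
      using Suc.prems by simp
    have "prefix_num y (Suc m) div 2 ^ (Suc m - l) = prefix_num y (Suc m) div 2 div 2 ^ (m - l)"
      using l by (simp add: Suc_diff_le div_mult2_eq)
    also have "prefix_num y (Suc m) div 2 = prefix_num y m"
      by simp
    finally show ?thesis
      using Suc.IH[OF l] by simp
  qed simp
qed simp

lemma prefix_num_eq_iff: "prefix_num y l = prefix_num z l \<longleftrightarrow> (\<forall>i<l. y i = z i)"
proof (induction l)
  case (Suc l)
  have "2 * a + of_bool p = 2 * c + of_bool q \<longleftrightarrow> a = c \<and> p = q" for a c :: nat and p q
    by (cases p; cases q) (simp_all, presburger+)
  then show ?case
    unfolding prefix_num.simps All_less_Suc using Suc by (simp add: conj_commute)
qed simp

lemma odd_prefix_num_div: "i < l \<Longrightarrow> odd (prefix_num y l div 2 ^ (l - Suc i)) \<longleftrightarrow> y i"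
  by (subst prefix_num_div) auto

lemma prefix_num_bits: "k < 2 ^ l \<Longrightarrow> prefix_num (\<lambda>i. odd (k div 2 ^ (l - Suc i))) l = k"
proof (induction l arbitrary: k)
  case (Suc l)
  have "prefix_num (\<lambda>i. odd (k div 2 ^ (Suc l - Suc i))) l =
      prefix_num (\<lambda>i. odd (k div 2 div 2 ^ (l - Suc i))) l"
    unfolding prefix_num_eq_iff
    by (auto simp: div_mult2_eq[symmetric] power_Suc[symmetric] Suc_diff_Suc simp del: power_Suc)
  also have "\<dots> = k div 2"
    using Suc.prems by (intro Suc.IH) auto
  finally have "prefix_num (\<lambda>i. odd (k div 2 ^ (Suc l - Suc i))) (Suc l) = 2 * (k div 2) + of_bool (odd k)"
    by (simp only: prefix_num.simps diff_self_eq_0 power_0 div_by_1)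
  also have "\<dots> = k"
    using mult_div_mod_eq[of 2 k] by (simp only: mod_2_eq_odd)
  finally show ?case .
qed simp

lemma bits_eq_iff:
  fixes a c :: nat
  assumes "a < 2 ^ l" "c < 2 ^ l"
  shows "(\<forall>i<l. odd (a div 2 ^ (l - Suc i)) \<longleftrightarrow> odd (c div 2 ^ (l - Suc i))) \<longleftrightarrow> a = c"
  unfolding prefix_num_eq_iff[of "\<lambda>i. odd (a div 2 ^ (l - Suc i))", symmetric]
  by (simp only: prefix_num_bits assms)

lemma prefix_num_ones: "(\<forall>i<n. y i) \<longleftrightarrow> 2 ^ n \<le> Suc (prefix_num y n)"
proof (induction n)
  case (Suc n)
  show ?case
    unfolding All_less_Suc Suc prefix_num.simps using prefix_num_less[of y n]
    by (cases "y n") auto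
qed simp

text \<open>The numbers that begin with n ones are the largest 2^(l-n) ones below 2^l. This
  identifies a base with the top fraction of the ranks.\<close>

lemma leading_ones_iff:
  fixes r :: nat
  assumes "r < 2 ^ l" "n \<le> l"
  shows "(\<forall>i<n. odd (r div 2 ^ (l - Suc i))) \<longleftrightarrow> 2 ^ l \<le> r + 2 ^ (l - n)"
proof -
  let ?y = "\<lambda>i. odd (r div 2 ^ (l - Suc i))"
  have "prefix_num ?y n = r div 2 ^ (l - n)"
    using prefix_num_div[OF assms(2), of ?y] prefix_num_bits[OF assms(1)] by simp
  then have "(\<forall>i<n. ?y i) \<longleftrightarrow> 2 ^ n \<le> (r + 2 ^ (l - n)) div 2 ^ (l - n)"
    by (simp add: prefix_num_ones)
  also have "\<dots> \<longleftrightarrow> 2 ^ n * 2 ^ (l - n) \<le> r + 2 ^ (l - n)"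
    by (rule less_eq_div_iff_mult_less_eq) simp
  also have "2 ^ n * 2 ^ (l - n) = (2 ^ l :: nat)"
    using assms(2) by (simp flip: power_add)
  finally show ?thesis .
qed

section \<open>Permuting the prefixes of a fixed length\<close>

definition permute_prefix :: "nat \<Rightarrow> (nat \<Rightarrow> nat) \<Rightarrow> cantor \<Rightarrow> cantor" where
  "permute_prefix l r y = (\<lambda>i. if i < l then odd (r (prefix_num y l) div 2 ^ (l - Suc i)) else y i)"

lemma prefix_bijection_permute_prefix:
  assumes r: "bij_betw r {..<2 ^ l} {..<2 ^ l}"
  shows "prefix_bijection l (permute_prefix l r)"
  unfolding prefix_bijection_def
proof (intro conjI allI impI)
  show "surj (permute_prefix l r)"
  proof (rule surjI)
    fix z
    let ?k = "inv_into {..<2 ^ l} r (prefix_num z l)"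
    let ?y = "\<lambda>i. if i < l then odd (?k div 2 ^ (l - Suc i)) else z i"
    have k: "?k < 2 ^ l" "r ?k = prefix_num z l"
      using r prefix_num_less[of z l] bij_betw_inv_into_right[OF r, of "prefix_num z l"]
        inv_into_into[of "prefix_num z l" r "{..<2 ^ l}"]
      by (auto simp: bij_betw_def)
    have "prefix_num ?y l = prefix_num (\<lambda>i. odd (?k div 2 ^ (l - Suc i))) l"
      unfolding prefix_num_eq_iff by simp
    then have "r (prefix_num ?y l) = prefix_num z l"
      using k by (simp add: prefix_num_bits)
    then show "permute_prefix l r ?y = z"
      unfolding permute_prefix_def by (intro ext) (simp add: odd_prefix_num_div)
  qed
  fix M y z assume M: "l \<le> M"
  have split: "(\<forall>i<M. P i) \<longleftrightarrow> (\<forall>i<l. P i) \<and> (\<forall>i<M. l \<le> i \<longrightarrow> P i)" for P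
    using M by (meson less_le_trans not_less)
  have range: "r (prefix_num w l) < 2 ^ l" for w
    using bij_betwE[OF r] prefix_num_less[of w l] by auto
  have "(\<forall>i<l. permute_prefix l r y i = permute_prefix l r z i) \<longleftrightarrow>
      r (prefix_num y l) = r (prefix_num z l)"
    unfolding bits_eq_iff[OF range range, symmetric] by (simp add: permute_prefix_def)
  also have "\<dots> \<longleftrightarrow> prefix_num y l = prefix_num z l"
    using r prefix_num_less by (auto simp: bij_betw_def dest!: inj_onD)
  also have "\<dots> \<longleftrightarrow> (\<forall>i<l. y i = z i)"
    by (rule prefix_num_eq_iff)
  finally have "(\<forall>i<l. permute_prefix l r y i = permute_prefix l r z i) \<longleftrightarrow> (\<forall>i<l. y i = z i)" .
  moreover have "(\<forall>i<M. l \<le> i \<longrightarrow> permute_prefix l r y i = permute_prefix l r z i) \<longleftrightarrow>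
      (\<forall>i<M. l \<le> i \<longrightarrow> y i = z i)"
    by (auto simp: permute_prefix_def)
  ultimately show "(\<forall>i<M. permute_prefix l r y i = permute_prefix l r z i) \<longleftrightarrow> (\<forall>i<M. y i = z i)"
    by (simp only: split[of "\<lambda>i. permute_prefix l r y i = permute_prefix l r z i"]
        split[of "\<lambda>i. y i = z i"])
qed

text \<open>\<open>cov j\<close> tests the prefix of length j at stage j. The disjunct
  \<open>l < j\<close> makes the search succeed and gives every uncovered string the value
  \<open>Suc l\<close>.\<close>

definition cover_time :: "(nat \<Rightarrow> nat \<Rightarrow> bool) \<Rightarrow> nat \<Rightarrow> nat \<Rightarrow> nat" where
  "cover_time cov l k = (LEAST j. l < j \<or> cov j (k div 2 ^ (l - j)))"

text \<open>
  In this order the strings that are not yet covered come last, and prolonging covered strings does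
  not change their order. Hence the top fraction \<open>2\<^sup>-\<^sup>n\<close>, taken at a length where it contains all
  uncovered strings, shrinks as \<open>n\<close> grows.
\<close>

definition precedes :: "(nat \<Rightarrow> nat \<Rightarrow> bool) \<Rightarrow> nat \<Rightarrow> nat \<Rightarrow> nat \<Rightarrow> bool" where
  "precedes cov l j k \<longleftrightarrow> cover_time cov l j < cover_time cov l k \<or>
     cover_time cov l j = cover_time cov l k \<and> j < k"

definition cover_rank :: "(nat \<Rightarrow> nat \<Rightarrow> bool) \<Rightarrow> nat \<Rightarrow> nat \<Rightarrow> nat" where
  "cover_rank cov l k = card {j. j < 2 ^ l \<and> precedes cov l j k}"

definition uncovered :: "(nat \<Rightarrow> nat \<Rightarrow> bool) \<Rightarrow> nat \<Rightarrow> nat" where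
  "uncovered cov l = card {k. k < 2 ^ l \<and> l < cover_time cov l k}"

text \<open>Up to l both searches test the same prefixes; after that the shorter string receives its
  default \<open>Suc l\<close>.\<close>

lemma cover_time_div:
  assumes "l \<le> m"
  shows "cover_time cov l (k div 2 ^ (m - l)) = min (cover_time cov m k) (Suc l)"
proof -
  let ?P = "\<lambda>j. m < j \<or> cov j (k div 2 ^ (m - j))"
  let ?Q = "\<lambda>j. l < j \<or> cov j (k div 2 ^ (m - l) div 2 ^ (l - j))"
  have PQ: "?Q j \<longleftrightarrow> ?P j" if "j \<le> l" for j
    using assms that by (simp add: div_mult2_eq[symmetric] flip: power_add)
  have P: "?P (Least ?P)"
    by (rule LeastI[of ?P "Suc m"]) simp
  have "Least ?Q = min (Least ?P) (Suc l)"
  proof (rule Least_equality)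
    show "?Q (min (Least ?P) (Suc l))"
      using P PQ[of "Least ?P"] by (cases "Least ?P \<le> l") (simp_all add: min_def)
    show "min (Least ?P) (Suc l) \<le> j" if "?Q j" for j
      using that PQ[of j] Least_le[of ?P j] by (cases "j \<le> l") (simp_all add: min_def)
  qed
  then show ?thesis
    by (simp only: cover_time_def)
qed

lemma precedes_trans: "precedes cov l i j \<Longrightarrow> precedes cov l j k \<Longrightarrow> precedes cov l i k"
  by (auto simp: precedes_def)

lemma cover_rank_less_cover_rank:
  assumes "precedes cov l j k" "j < 2 ^ l"
  shows "cover_rank cov l j < cover_rank cov l k"
  unfolding cover_rank_def
proof (rule psubset_card_mono)
  have "j \<notin> {i. i < 2 ^ l \<and> precedes cov l i j}"
    by (simp add: precedes_def)
  then show "{i. i < 2 ^ l \<and> precedes cov l i j} \<subset> {i. i < 2 ^ l \<and> precedes cov l i k}"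
    using assms precedes_trans by blast
qed simp

lemma cover_rank_less:
  assumes "k < 2 ^ l"
  shows "cover_rank cov l k < 2 ^ l"
proof -
  have "cover_rank cov l k < card {..<2 ^ l :: nat}"
    unfolding cover_rank_def by (rule psubset_card_mono) (use assms in \<open>auto simp: precedes_def\<close>)
  then show ?thesis
    by simp
qed

lemma bij_betw_cover_rank: "bij_betw (cover_rank cov l) {..<2 ^ l} {..<2 ^ l}"
proof -
  have "inj_on (cover_rank cov l) {..<2 ^ l}"
  proof (rule inj_onI)
    fix j k :: nat assume *: "j \<in> {..<2 ^ l}" "k \<in> {..<2 ^ l}" "cover_rank cov l j = cover_rank cov l k"
    have "j = k \<or> precedes cov l j k \<or> precedes cov l k j"
      by (auto simp: precedes_def)
    then show "j = k"
      using * cover_rank_less_cover_rank by (metis lessThan_iff less_irrefl)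
  qed
  moreover have "cover_rank cov l ` {..<2 ^ l} \<subseteq> {..<2 ^ l}"
    using cover_rank_less by auto
  ultimately show ?thesis
    by (simp add: bij_betw_def endo_inj_surj)
qed

text \<open>A string that does not precede an uncovered one is itself uncovered, so the uncovered
  strings occupy the top ranks.\<close>

lemma cover_rank_uncovered:
  assumes "l < cover_time cov l k"
  shows "2 ^ l \<le> cover_rank cov l k + uncovered cov l"
proof -
  have "{..<2 ^ l :: nat} \<subseteq> {j. j < 2 ^ l \<and> precedes cov l j k} \<union> {k. k < 2 ^ l \<and> l < cover_time cov l k}"
    using assms by (auto simp: precedes_def)
  then have "card {..<2 ^ l :: nat} \<le>
      card ({j. j < 2 ^ l \<and> precedes cov l j k} \<union> {k. k < 2 ^ l \<and> l < cover_time cov l k})"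
    by (intro card_mono) auto
  also have "\<dots> \<le> cover_rank cov l k + uncovered cov l"
    unfolding cover_rank_def uncovered_def by (rule card_Un_le)
  finally show ?thesis
    by simp
qed

text \<open>Whatever precedes v at length m was also covered by stage l, so its truncation to length
  l does not come after that of v. Each truncation has 2^(m-l) prolongations. The successors count v
  and its truncation themselves.\<close>

lemma cover_rank_covered:
  assumes "l \<le> m" "v < 2 ^ m" and covered: "cover_time cov l (v div 2 ^ (m - l)) \<le> l"
  shows "Suc (cover_rank cov m v) \<le> 2 ^ (m - l) * Suc (cover_rank cov l (v div 2 ^ (m - l)))"
proof -
  let ?d = "\<lambda>u :: nat. u div 2 ^ (m - l)"
  let ?S = "insert v {u. u < 2 ^ m \<and> precedes cov m u v}"
  let ?R = "insert (?d v) {u. u < 2 ^ l \<and> precedes cov l u (?d v)}"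
  have time_v: "cover_time cov l (?d v) = cover_time cov m v" "cover_time cov m v \<le> l"
    using covered by (simp_all add: cover_time_div[OF assms(1)] min_def split: if_splits)
  have "?d u \<in> ?R" if "u < 2 ^ m" "precedes cov m u v" for u
  proof -
    have "cover_time cov m u \<le> l"
      using that(2) time_v by (auto simp: precedes_def)
    then have "cover_time cov l (?d u) = cover_time cov m u"
      by (simp add: cover_time_div[OF assms(1)])
    moreover have "?d u \<le> ?d v" if "u < v"
      using that by (intro div_le_mono) simp
    moreover have "?d u < 2 ^ l"
      using \<open>u < 2 ^ m\<close> assms(1) by (simp add: div_less_iff_less_mult flip: power_add)
    ultimately show ?thesis
      using that(2) time_v by (auto simp: precedes_def)
  qed
  then have "(\<lambda>u. (?d u, u mod 2 ^ (m - l))) ` ?S \<subseteq> ?R \<times> {..<2 ^ (m - l)}"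
    by auto
  moreover have "inj_on (\<lambda>u. (?d u, u mod 2 ^ (m - l))) ?S"
    by (rule inj_onI) (metis div_mult_mod_eq prod.inject)
  ultimately have "card ?S \<le> card (?R \<times> {..<2 ^ (m - l) :: nat})"
    by (intro card_inj_on_le[of "\<lambda>u. (?d u, u mod 2 ^ (m - l))"]) auto
  moreover have "card ?S = Suc (cover_rank cov m v)"
    unfolding cover_rank_def by (rule card_insert_disjoint) (auto simp: precedes_def)
  moreover have "card ?R = Suc (cover_rank cov l (?d v))"
    unfolding cover_rank_def by (rule card_insert_disjoint) (auto simp: precedes_def)
  ultimately show ?thesis
    by (simp only: card_cartesian_product card_lessThan mult.commute)
qed

lemma less_cover_time_prefix_num:
  "l < cover_time cov l (prefix_num y l) \<longleftrightarrow> (\<forall>j\<le>l. \<not> cov j (prefix_num y j))"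
proof -
  let ?P = "\<lambda>j. l < j \<or> cov j (prefix_num y l div 2 ^ (l - j))"
  have P: "?P j \<longleftrightarrow> cov j (prefix_num y j)" if "j \<le> l" for j
    using that by (simp add: prefix_num_div)
  have Least: "?P (Least ?P)"
    by (rule LeastI[of ?P "Suc l"]) simp
  show ?thesis
    unfolding cover_time_def
  proof
    assume less: "l < Least ?P"
    show "\<forall>j\<le>l. \<not> cov j (prefix_num y j)"
    proof (intro allI impI)
      fix j assume j: "j \<le> l"
      then have "\<not> ?P j"
        using less by (intro not_less_Least) simp
      then show "\<not> cov j (prefix_num y j)"
        using P[OF j] by simp
    qed
  next
    assume not_cov: "\<forall>j\<le>l. \<not> cov j (prefix_num y j)"
    show "l < Least ?P"
    proof (rule ccontr)
      assume "\<not> l < Least ?P"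
      then have le: "Least ?P \<le> l"
        by simp
      with Least P[OF le] not_cov show False
        by blast
    qed
  qed
qed

text \<open>This makes the cardinalities in \<open>cover_rank\<close> and \<open>uncovered\<close>
  recursive.\<close>

lemma card_less_eq_sum: "card {i. i < n \<and> P i} = (\<Sum>i<n. of_bool (P i))" for n :: nat
proof -
  have "{i. i < n \<and> P i} = {i \<in> {..<n}. P i}"
    by auto
  then show ?thesis
    by (simp add: sum.If_cases of_bool_def Int_def)
qed

lemma recursive_prefix_num:
  assumes "recursive_fun f" "recursive_fun g"
  shows "recursive_fun (\<lambda>e. prefix_num (code_seq (f e)) (g e))"
proof -
  have "prefix_num y l = rec_nat 0 (\<lambda>i r. 2 * r + of_bool (y i)) l" for y l
    by (induction l) auto
  then have "recursive_fun (\<lambda>p. prefix_num (code_seq (pfst p)) (psnd p))"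
    by (simp only:) (intro recursive_rec_nat recursive_intros decidable_code_seq)
  then show ?thesis
    using assms by (rule recursive_comp2)
qed

text \<open>The quotient of \<open>uncovered cov l\<close> by 2^l is the measure of the points still
  uncovered at stage l. The last assumption says in integers that it drops below every 2^-n, which
  makes the search for \<open>level\<close> total.\<close>

locale null_cover =
  fixes cov :: "nat \<Rightarrow> nat \<Rightarrow> bool" and y0 :: cantor
  assumes decidable_cov: "decidable (\<lambda>p. cov (pfst p) (psnd p))"
    and not_cov_y0: "\<not> cov l (prefix_num y0 l)"
    and null: "\<exists>l. 2 ^ n * uncovered cov l \<le> 2 ^ l"
begin

definition level :: "nat \<Rightarrow> nat" where
  "level n = (LEAST l. 2 ^ n * uncovered cov l \<le> 2 ^ l)"

definition level_map :: "nat \<Rightarrow> cantor \<Rightarrow> cantor" where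
  "level_map n = permute_prefix (level n) (cover_rank cov (level n))"

lemma uncovered_level: "2 ^ n * uncovered cov (level n) \<le> 2 ^ level n"
  unfolding level_def by (rule LeastI_ex[OF null])

lemma cover_time_y0: "l < cover_time cov l (prefix_num y0 l)"
  by (simp add: less_cover_time_prefix_num not_cov_y0)

lemma uncovered_pos: "0 < uncovered cov l"
  unfolding uncovered_def card_gt_0_iff using cover_time_y0 prefix_num_less by auto

text \<open>The prefix of \<open>y0\<close> is always uncovered, so a measure of at most 2^-n
  requires length at least n. This leaves room for n leading ones.\<close>

lemma le_level: "n \<le> level n"
proof -
  have "2 ^ n * 1 \<le> 2 ^ n * uncovered cov (level n)"
    using uncovered_pos[of "level n"] by (intro mult_le_mono) auto
  also note uncovered_level
  finally show ?thesis
    by simp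
qed

lemma level_Suc: "level n \<le> level (Suc n)"
proof -
  have "2 ^ n * uncovered cov (level (Suc n)) \<le> 2 ^ level (Suc n)"
    using uncovered_level[of "Suc n"] by simp
  then show ?thesis
    unfolding level_def[of n] by (rule Least_le)
qed

lemma level_0: "level 0 = 0"
proof -
  have "uncovered cov 0 \<le> card {..<1 :: nat}"
    unfolding uncovered_def by (rule card_mono) auto
  then show ?thesis
    unfolding level_def by (intro Least_equality) auto
qed

lemma level_map_ones:
  "(\<forall>i<n. level_map n y i) \<longleftrightarrow>
    2 ^ level n \<le> cover_rank cov (level n) (prefix_num y (level n)) + 2 ^ (level n - n)"
proof -
  have "(\<forall>i<n. level_map n y i) \<longleftrightarrow>
      (\<forall>i<n. odd (cover_rank cov (level n) (prefix_num y (level n)) div 2 ^ (level n - Suc i)))"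
    using le_level[of n] by (auto simp: level_map_def permute_prefix_def)
  also have "\<dots> \<longleftrightarrow> 2 ^ level n \<le> cover_rank cov (level n) (prefix_num y (level n)) + 2 ^ (level n - n)"
    by (intro leading_ones_iff cover_rank_less prefix_num_less le_level)
  finally show ?thesis .
qed

text \<open>By the choice of the level there are at most 2^(l-n) uncovered strings at l =
  \<open>level n\<close>, so all of them fit into the top fraction.\<close>

lemma level_map_ones_uncovered:
  assumes "level n < cover_time cov (level n) (prefix_num y (level n))"
  shows "\<forall>i<n. level_map n y i"
proof -
  have "2 ^ n * uncovered cov (level n) \<le> 2 ^ n * 2 ^ (level n - n)"
    using uncovered_level[of n] le_level[of n] by (simp flip: power_add)
  then have "uncovered cov (level n) \<le> 2 ^ (level n - n)"
    by simp
  then show ?thesis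
    unfolding level_map_ones using cover_rank_uncovered[OF assms] by linarith
qed

text \<open>A point uncovered at level n is in the top fraction there anyway. For a covered point,
  \<open>cover_rank_covered\<close> allows the rank inequality at the finer level to be divided by
  2^(m-l); its successor terms become the strict inequality at the end.\<close>

lemma level_map_mono:
  assumes "\<forall>i<Suc n. level_map (Suc n) y i"
  shows "\<forall>i<n. level_map n y i"
proof (cases "level n < cover_time cov (level n) (prefix_num y (level n))")
  case True
  then show ?thesis
    by (rule level_map_ones_uncovered)
next
  case False
  define l where "l = level n"
  define m where "m = level (Suc n)"
  define r where "r = cover_rank cov l (prefix_num y l)"
  define s where "s = cover_rank cov m (prefix_num y m)"
  have lm: "l \<le> m" "n \<le> l" "Suc n \<le> m"
    using level_Suc[of n] le_level[of n] le_level[of "Suc n"] by (simp_all add: l_def m_def)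
  have "2 ^ m \<le> s + 2 ^ (m - Suc n)"
    using assms unfolding level_map_ones by (simp add: s_def m_def)
  moreover have "Suc s \<le> 2 ^ (m - l) * Suc r"
  proof -
    have "cover_time cov l (prefix_num y l) \<le> l"
      using False by (simp add: l_def)
    then show ?thesis
      using cover_rank_covered[OF lm(1) prefix_num_less, of cov y, unfolded prefix_num_div[OF lm(1)]]
      by (simp only: r_def s_def)
  qed
  moreover have "(2 :: nat) ^ (m - Suc n) \<le> 2 ^ (m - l) * 2 ^ (l - n)"
    using lm by (simp flip: power_add)
  moreover have "(2 :: nat) ^ m = 2 ^ (m - l) * 2 ^ l"
    using lm by (simp flip: power_add)
  ultimately have "2 ^ (m - l) * 2 ^ l < 2 ^ (m - l) * (Suc r + 2 ^ (l - n))"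
    by (simp only: distrib_left)
  then have "2 ^ l < Suc r + 2 ^ (l - n)"
    by (rule mult_less_cancel1[THEN iffD1, THEN conjunct2])
  then show ?thesis
    unfolding level_map_ones l_def[symmetric] r_def[symmetric] by simp
qed

lemma recursive_cover_time:
  assumes "recursive_fun f" "recursive_fun g"
  shows "recursive_fun (\<lambda>e. cover_time cov (f e) (g e))"
proof -
  have "\<exists>j. l < j \<or> cov j (k div 2 ^ (l - j))" for l k
    by (rule exI[of _ "Suc l"]) simp
  then have "recursive_fun (\<lambda>p. cover_time cov (pfst p) (psnd p))"
    unfolding cover_time_def
    by (intro recursive_LEAST recursive_intros decidable_comp2[OF decidable_cov] recursive_div) simp_all
  then show ?thesis
    using assms by (rule recursive_comp2)
qed

lemma recursive_cover_rank:
  assumes "recursive_fun f" "recursive_fun g"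
  shows "recursive_fun (\<lambda>e. cover_rank cov (f e) (g e))"
proof -
  have "recursive_fun (\<lambda>p. cover_rank cov (pfst p) (psnd p))"
    unfolding cover_rank_def card_less_eq_sum precedes_def
    by (intro recursive_intros recursive_cover_time)
  then show ?thesis
    using assms by (rule recursive_comp2)
qed

lemma recursive_level: "recursive_fun level"
proof -
  have "recursive_fun (\<lambda>n. LEAST l. 2 ^ n * uncovered cov l \<le> 2 ^ l)"
    using null unfolding uncovered_def card_less_eq_sum
    by (intro recursive_LEAST recursive_intros recursive_cover_time)
  then show ?thesis
    by (simp add: level_def[abs_def])
qed

lemma skyscraper_level_map: "skyscraper level level_map"
proof
  show "level_map 0 y = y" for y
    by (simp add: level_map_def permute_prefix_def level_0)
  show "prefix_bijection (level n) (level_map n)" for n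
    unfolding level_map_def by (intro prefix_bijection_permute_prefix bij_betw_cover_rank)
  show "level_map n y i" if "\<And>i. i < Suc n \<Longrightarrow> level_map (Suc n) y i" "i < n" for n y i
    using level_map_mono[of n y] that by blast
  show "decidable (\<lambda>p. level_map (pfst p) (code_seq (pfst (psnd p))) (psnd (psnd p)))"
    unfolding level_map_def permute_prefix_def
    by (intro recursive_intros recursive_div recursive_cover_rank recursive_prefix_num decidable_code_seq
        recursive_fun.comp[OF recursive_level]) simp
qed (rule recursive_level)

lemma level_map_y0: "i < n \<Longrightarrow> level_map n y0 i"
  using level_map_ones_uncovered[OF cover_time_y0] by blast

end

section \<open>Measure of the uncovered sets\<close>

lemma uncovered_eq_UN_cylinder:
  "{y. \<forall>j\<le>l. \<not> cov j (prefix_num y j)} =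
    (\<Union>k\<in>{k. k < 2 ^ l \<and> l < cover_time cov l k}. cylinder (map (\<lambda>i. odd (k div 2 ^ (l - Suc i))) [0..<l]))"
proof -
  have E: "y \<in> cylinder (map (\<lambda>i. odd (k div 2 ^ (l - Suc i))) [0..<l]) \<longleftrightarrow> prefix_num y l = k"
    if "k < 2 ^ l" for k y
    using prefix_num_bits[OF that] prefix_num_eq_iff[of y l "\<lambda>i. odd (k div 2 ^ (l - Suc i))"]
    by (simp add: cylinder_map)
  show ?thesis
  proof (intro set_eqI)
    fix y
    show "y \<in> {y. \<forall>j\<le>l. \<not> cov j (prefix_num y j)} \<longleftrightarrow>
      y \<in> (\<Union>k\<in>{k. k < 2 ^ l \<and> l < cover_time cov l k}. cylinder (map (\<lambda>i. odd (k div 2 ^ (l - Suc i))) [0..<l]))"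
      using prefix_num_less[of y l] by (auto simp: less_cover_time_prefix_num[symmetric] E)
  qed
qed

lemma borel_uncovered: "{y. \<forall>j\<le>l. \<not> cov j (prefix_num y j)} \<in> sets borel"
  unfolding uncovered_eq_UN_cylinder by (intro sets.finite_UN cylinder_borel) simp

lemma measure_uncovered:
  "measure cantor_measure {y. \<forall>j\<le>l. \<not> cov j (prefix_num y j)} = uncovered cov l / 2 ^ l"
proof -
  interpret prob_space cantor_measure
    by (rule prob_space_cantor_measure)
  let ?K = "{k. k < 2 ^ l \<and> l < cover_time cov l k}"
  define E where "E k = cylinder (map (\<lambda>i. odd (k div 2 ^ (l - Suc i))) [0..<l])" for k :: nat
  have "disjoint_family_on E ?K"
    unfolding disjoint_family_on_def
  proof (intro ballI impI, rule ccontr)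
    fix j k assume *: "j \<in> ?K" "k \<in> ?K" "j \<noteq> k" "E j \<inter> E k \<noteq> {}"
    then obtain y where "y \<in> E j" "y \<in> E k"
      by blast
    then have "\<forall>i<l. odd (j div 2 ^ (l - Suc i)) \<longleftrightarrow> odd (k div 2 ^ (l - Suc i))"
      by (simp add: E_def cylinder_map)
    moreover have "j < 2 ^ l" "k < 2 ^ l"
      using * by simp_all
    ultimately show False
      using * bits_eq_iff by blast
  qed
  then have "prob (\<Union>k\<in>?K. E k) = (\<Sum>k\<in>?K. prob (E k))"
    by (intro finite_measure_finite_Union) (auto simp: sets_cantor_measure, simp add: E_def)
  also have "\<dots> = (\<Sum>k\<in>?K. (1/2) ^ l)"
    by (rule sum.cong) (simp_all add: E_def measure_cylinder)
  finally show ?thesis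
    by (simp add: uncovered_eq_UN_cylinder E_def uncovered_def power_divide)
qed

text \<open>Continuity from above: the sets uncovered up to stage l decrease to a null set.\<close>

lemma uncovered_le:
  assumes "emeasure cantor_measure {y. \<forall>j. \<not> cov j (prefix_num y j)} = 0"
  shows "\<exists>l. 2 ^ n * uncovered cov l \<le> 2 ^ l"
proof -
  interpret prob_space cantor_measure
    by (rule prob_space_cantor_measure)
  define E where "E l = {y. \<forall>j\<le>l. \<not> cov j (prefix_num y j)}" for l
  have "(\<lambda>l. prob (E l)) \<longlonglongrightarrow> prob (\<Inter>l. E l)"
    by (rule finite_Lim_measure_decseq)
       (auto simp: E_def sets_cantor_measure borel_uncovered decseq_def)
  also have "(\<Inter>l. E l) = {y. \<forall>j. \<not> cov j (prefix_num y j)}"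
    by (auto simp: E_def)
  also have "prob \<dots> = 0"
    using assms by (simp add: measure_def)
  finally have "(\<lambda>l. prob (E l)) \<longlonglongrightarrow> 0" .
  moreover have "(0 :: real) < (1/2) ^ n"
    by simp
  ultimately have "\<forall>\<^sub>F l in sequentially. prob (E l) < (1/2) ^ n"
    by (rule order_tendstoD(2))
  then obtain l where "prob (E l) < (1/2) ^ n"
    by (auto simp: eventually_sequentially)
  then have "real (2 ^ n * uncovered cov l) < real (2 ^ l)"
    by (simp add: E_def measure_uncovered power_divide field_simps)
  then show ?thesis
    by (intro exI[of _ l]) (simp only: of_nat_less_iff less_imp_le)
qed

section \<open>Points that are not Kurtz random\<close>

theorem theorem2p9:
  fixes x :: cantor
  assumes "\<not> Kurtz_random x"
  shows "\<exists>(A :: cantor set) (T :: cantor \<rightharpoonup> cantor).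
           open A \<and> closed A \<and> x \<in> A \<and> emeasure cantor_measure A > 0 \<and>
           inj_on T (dom T) \<and>
           measure_preserving_transformation T \<and>
           computable_transformation T \<and>
           ergodic_transformation T \<and>
           Sigma01 (dom T) \<and> A \<subseteq> dom T \<and>
           (\<forall>k>0. \<exists>y. partial_iterate T k x = Some y \<and> y \<notin> A)"
proof -
  obtain P where P: "Pi01 P" "emeasure cantor_measure P = 0" "x \<in> P"
    using assms by (auto simp: Kurtz_random_def)
  obtain W where W: "ce_strings W" "- P = (\<Union>\<sigma>\<in>W. cylinder \<sigma>)"
    using P(1) by (auto simp: Pi01_def Sigma01_def)
  \<comment> \<open>This excludes the empty case of \<open>ce\<close>, so an enumeration f
    exists.\<close>
  have "P \<noteq> UNIV"
    using P(2) emeasure_cantor_measure_UNIV by auto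
  then have "W \<noteq> {}"
    using W(2) by auto
  then obtain f where f: "recursive_fun f" "string_code ` W = range f"
    using W(1) by (auto simp: ce_strings_def ce_def)
  define b where "b = x 0"
  define y0 where "y0 = (\<lambda>i. x (Suc i))"
  define prepend :: "cantor \<Rightarrow> cantor" where "prepend y = (\<lambda>j. if j = 0 then b else y (j - 1))" for y
  \<comment> \<open>One of the first l + 1 enumerated strings is an initial segment of b followed by
    the l bits of k. The bit b explains the length bound \<open>Suc l\<close>, and it shifts entry j
    of the point to bit j - 1 of k, which is the parity of \<open>k div 2 ^ (l - j)\<close>.\<close>
  define cov where "cov l k \<longleftrightarrow> (\<exists>i<Suc l. code_length (f i) \<le> Suc l \<and>
      (\<forall>j<code_length (f i). code_seq (f i) j \<longleftrightarrow> (if j = 0 then b else odd (k div 2 ^ (l - j)))))" for l k :: nat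
  have x: "prepend y0 = x"
    by (auto simp: prepend_def y0_def b_def fun_eq_iff)
  have cov_iff: "cov l (prefix_num y l) \<longleftrightarrow> (\<exists>i<Suc l. code_length (f i) \<le> Suc l \<and>
      (\<forall>j<code_length (f i). code_seq (f i) j = prepend y j))" for l y
  proof -
    have "(if j = 0 then b else odd (prefix_num y l div 2 ^ (l - j))) = prepend y j" if "j \<le> l" for j
      using that odd_prefix_num_div[of "j - 1" l y] by (cases j) (auto simp: prepend_def)
    then have "(if j = 0 then b else odd (prefix_num y l div 2 ^ (l - j))) = prepend y j"
      if "j < m" "m \<le> Suc l" for j m
      using that by simp
    then show ?thesis
      unfolding cov_def by (simp cong: conj_cong)
  qed
  have cov_P: "(\<forall>l. \<not> cov l (prefix_num y l)) \<longleftrightarrow> prepend y \<in> P" for y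
  proof
    assume not_cov: "\<forall>l. \<not> cov l (prefix_num y l)"
    show "prepend y \<in> P"
    proof (rule ccontr)
      assume "prepend y \<notin> P"
      then obtain \<sigma> where \<sigma>: "\<sigma> \<in> W" "prepend y \<in> cylinder \<sigma>"
        using W(2) by blast
      then obtain i where i: "string_code \<sigma> = f i"
        using f(2) by (metis imageI rangeE)
      \<comment> \<open>A stage that exceeds both the index and the length of \<sigma>.\<close>
      have "cov (i + length \<sigma>) (prefix_num y (i + length \<sigma>))"
        unfolding cov_iff using \<sigma>(2)
        by (intro exI[of _ i]) (auto simp: i[symmetric] code_seq_string_code cylinder_def)
      then show False
        using not_cov by blast
    qed
  next
    assume y: "prepend y \<in> P"
    show "\<forall>l. \<not> cov l (prefix_num y l)"
    proof (intro allI notI)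
      fix l assume "cov l (prefix_num y l)"
      then obtain i where i: "\<forall>j<code_length (f i). code_seq (f i) j = prepend y j"
        unfolding cov_iff by blast
      obtain \<sigma> where \<sigma>: "\<sigma> \<in> W" "f i = string_code \<sigma>"
        using f(2) by (metis imageE rangeI)
      have "prepend y \<in> cylinder \<sigma>"
        using i by (simp add: cylinder_def \<sigma>(2) code_seq_string_code)
      then show False
        using W(2) \<sigma>(1) y by blast
    qed
  qed
  define Q where "Q = {y. \<forall>j. \<not> cov j (prefix_num y j)}"
  have "Q = (\<Inter>l. {y. \<forall>j\<le>l. \<not> cov j (prefix_num y j)})"
    by (auto simp: Q_def)
  also have "\<dots> \<in> sets borel"
    by (intro sets.countable_INT'' UNIV_I borel_uncovered countableI_type) simp
  finally have Q: "Q \<in> sets borel" .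
  \<comment> \<open>Prefixing b to Q stays inside P and halves the measure, so Q is null as
    well.\<close>
  have "prepend (\<lambda>i. z (i + length [b])) = z" if "z \<in> cylinder [b]" for z
    using that by (auto simp: prepend_def cylinder_def fun_eq_iff)
  then have "{z \<in> cylinder [b]. (\<lambda>i. z (i + length [b])) \<in> Q} \<subseteq> P"
    by (auto simp: Q_def cov_P)
  moreover have "P \<in> sets borel"
  proof -
    have "open (- P)"
      unfolding W(2) by (intro open_UN ballI open_cylinder)
    then show ?thesis
      by (simp add: borel_closed closed_def)
  qed
  ultimately have "emeasure cantor_measure {z \<in> cylinder [b]. (\<lambda>i. z (i + length [b])) \<in> Q} = 0"
    by (intro emeasure_eq_0[OF _ P(2)]) (simp add: sets_cantor_measure)
  then have Q_null: "emeasure cantor_measure Q = 0"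
    unfolding emeasure_cylinder_shift[OF Q] by simp
  interpret null_cover cov y0
  proof
    show "decidable (\<lambda>p. cov (pfst p) (psnd p))"
      unfolding cov_def
      by (intro recursive_intros recursive_div decidable_code_seq recursive_fun.comp[OF f(1)]) simp
    show "\<not> cov l (prefix_num y0 l)" for l
      using cov_P[of y0] x P(3) by simp
    show "\<exists>l. 2 ^ n * uncovered cov l \<le> 2 ^ l" for n
      using Q_null unfolding Q_def by (rule uncovered_le)
  qed
  interpret skyscraper b level level_map
    by (rule skyscraper_level_map)
  have y0: "y0 \<in> base n" for n
    by (simp add: base_def level_map_y0)
  have x_eq: "x = floor_point 0 y0"
    by (simp add: floor_point_def h_0 x[symmetric] prepend_def fun_eq_iff)
  show ?thesis
  proof (intro exI[of _ "cylinder [b]"] exI[of _ T] conjI allI impI)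
    have "- cylinder [b] = cylinder [\<not> b]"
      by (auto simp: cylinder_def)
    then show "closed (cylinder [b])"
      by (simp add: closed_def open_cylinder)
    show "cylinder [b] \<subseteq> dom T"
      by (auto simp: dom_T cylinder_def)
    show "\<exists>y. partial_iterate T k x = Some y \<and> y \<notin> cylinder [b]" if "k > 0" for k
      \<comment> \<open>The k-th iterate lies on floor k, whose points begin with
        \<open>\<not> b\<close> when k is positive.\<close>
      using that unfolding x_eq partial_iterate_floor_point[OF y0]
      by (simp add: cylinder_def floor_point_def)
    show "emeasure cantor_measure (cylinder [b]) > 0"
      by (simp add: emeasure_cylinder ennreal_zero_less_divide)
  qed (simp_all add: open_cylinder inj_on_T measure_preserving_T computable_T
      ergodic_T Sigma01_dom_T, simp_all add: cylinder_def b_def)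
qed

end
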